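(* Let $\mathcal{P}$ be a predicate on labeled cycles. If there exists a radius-1 proof-labeling scheme $(\mathbf{p},\mathbf{v})$ for $\mathcal{P}$ (on labeled cycles) of size $k$, then for every $t\ge 1$, $\mathsf{size\text{-}pls}(\mathcal{P},t)=O\left(\left\lceil \frac{k}{t}\right\rceil\right)$. The same holds for predicates on 2-dimensional labeled grids: if $\mathcal{P}$ is a predicate on 2-dimensional labeled grids having a radius-1 proof-labeling scheme of size $k$, then for every $t\ge1$, $\mathsf{size\text{-}pls}(\mathcal{P},t)=O\left(\left\lceil \frac{k}{t}\right\rceil\right)$. (Here $k$ may depend on the number $n$ of nodes, and the constants hidden in the $O$ do not depend on $n$ or $t$.)
   Context: Model. A labeled graph is a pair $(G,x)$ where $G=(V,E)$ is a finite connected simple graph and $x:V\to\{0,1\}^*$ assigns a bit-string (label) to every node; a labeled cycle (respectively, 2-dimensional labeled grid) is a labeled graph whose underlying graph is a cycle (respectively, a $p\times q$ grid). An identity assignment is an injective map $\mathrm{ID}:V\to[1,n^c]$ for some fixed $c\ge 1$, where $n=|V|$. A predicate $\mathcal{P}$ on a class of labeled graphs is a Boolean function of $(G,x)$ (possibly depending also on $\mathrm{ID}$). A proof-labeling scheme (PLS) for $\mathcal{P}$ is a pair $(\mathbf{p},\mathbf{v})$, where the prover $\mathbf{p}$ assigns to every node $v$ of every instance $(G,x,\mathrm{ID})$ a bit-string called certificate, and the verifier $\mathbf{v}$ is a deterministic distributed algorithm in the LOCAL model in which every node outputs accept or reject, such that: (i) if $(G,x,\mathrm{ID})$ satisfies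 $\mathcal{P}$, then all nodes accept with the certificates given by $\mathbf{p}$; (ii) if $(G,x,\mathrm{ID})$ does not satisfy $\mathcal{P}$, then for every assignment of certificates to the nodes, at least one node rejects. The radius of the scheme is the maximum number of rounds of $\mathbf{v}$; a $t$-PLS is a scheme of radius $t$: equivalently, each node $v$ decides from $t$, the structure of the ball of radius $t$ around $v$, and the identities, labels and certificates of the nodes at distance at most $t$ from $v$ (arbitrary local computation is allowed). The size of a scheme, as a function of $n$, is the maximum number of bits of a certificate assigned by $\mathbf{p}$ to a node, over all $n$-node instances satisfying $\mathcal{P}$. $\mathsf{size\text{-}pls}(\mathcal{P},t)$ is the minimum size of a PLS for $\mathcal{P}$ of radius at most $t$ on the considered class of $n$-node labeled graphs. *)

theory Defs
  imports Complex_Main "HOL-Library.Extended_Nat"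
begin

section \<open>Labeled graphs with identities\<close>

text \<open>
  Edges are a symmetric irreflexive relation. The functions \<^term>\<open>label\<close> and \<^term>\<open>ident\<close> are
  total; only their values on \<^term>\<open>verts\<close> are meaningful, and only these are visible to a verifier.
\<close>

record 'v inst =
  verts :: "'v set"
  adj :: "('v \<times> 'v) set"
  label :: "'v \<Rightarrow> bool list"
  ident :: "'v \<Rightarrow> nat"

definition connected_simple_graph :: "'v set \<Rightarrow> ('v \<times> 'v) set \<Rightarrow> bool" where
  "connected_simple_graph V E \<longleftrightarrow>
     finite V \<and> V \<noteq> {} \<and> E \<subseteq> V \<times> V \<and> sym E \<and> irrefl E \<and> V \<times> V \<subseteq> E\<^sup>*"

definition graph_iso :: "'v set \<Rightarrow> ('v \<times> 'v) set \<Rightarrow> 'w set \<Rightarrow> ('w \<times> 'w) set \<Rightarrow> bool" where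
  "graph_iso V E W F \<longleftrightarrow>
     (\<exists>f. bij_betw f V W \<and> (\<forall>u\<in>V. \<forall>v\<in>V. (u, v) \<in> E \<longleftrightarrow> (f u, f v) \<in> F))"

definition cycle_adj :: "nat \<Rightarrow> (nat \<times> nat) set" where
  "cycle_adj n = {(i, j). i < n \<and> j < n \<and> (j = Suc i mod n \<or> i = Suc j mod n)}"

definition grid_adj :: "nat \<Rightarrow> nat \<Rightarrow> ((nat \<times> nat) \<times> (nat \<times> nat)) set" where
  "grid_adj p q = {((i, j), (i', j')). i < p \<and> i' < p \<and> j < q \<and> j' < q \<and>
     (i = i' \<and> (j' = Suc j \<or> j = Suc j') \<or> j = j' \<and> (i' = Suc i \<or> i = Suc i'))}"

definition labeled_cycle :: "'v inst \<Rightarrow> bool" where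
  "labeled_cycle I \<longleftrightarrow> connected_simple_graph (verts I) (adj I) \<and>
     (\<exists>n\<ge>3. graph_iso (verts I) (adj I) {..<n} (cycle_adj n))"

definition labeled_grid :: "'v inst \<Rightarrow> bool" where
  "labeled_grid I \<longleftrightarrow> connected_simple_graph (verts I) (adj I) \<and>
     (\<exists>p\<ge>1. \<exists>q\<ge>1. graph_iso (verts I) (adj I) ({..<p} \<times> {..<q}) (grid_adj p q))"

definition identity_assignment :: "nat \<Rightarrow> 'v inst \<Rightarrow> bool" where
  "identity_assignment c I \<longleftrightarrow>
     inj_on (ident I) (verts I) \<and> ident I ` verts I \<subseteq> {1..card (verts I) ^ c}"

section \<open>Local views\<close>

definition dist_ball :: "'v inst \<Rightarrow> nat \<Rightarrow> 'v \<Rightarrow> 'v set" where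
  "dist_ball I r v = {u. \<exists>k\<le>r. (v, u) \<in> adj I ^^ k}"

text \<open>
  A view names nodes by their identities. As these are pairwise distinct, the view determines
  the ball up to isomorphism and carries no information about the underlying vertices.
  After \<open>r\<close> rounds a node knows exactly the edges incident to a node at distance less than \<open>r\<close>,
  so an edge between two nodes at distance exactly \<open>r\<close> is not part of its view.
\<close>

record view =
  view_center :: nat
  view_nodes :: "(nat \<times> bool list \<times> bool list) set"
  view_adj :: "(nat \<times> nat) set"

definition local_view :: "'v inst \<Rightarrow> ('v \<Rightarrow> bool list) \<Rightarrow> nat \<Rightarrow> 'v \<Rightarrow> view" where
  "local_view I cert r v =
     \<lparr>view_center = ident I v,
      view_nodes = {(ident I u, label I u, cert u) | u. u \<in> dist_ball I r v},
      view_adj = {(ident I u, ident I w) | u w.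
        (u, w) \<in> adj I \<and> (\<exists>k<r. u \<in> dist_ball I k v \<or> w \<in> dist_ball I k v)}\<rparr>"

section \<open>Proof-labeling schemes\<close>

text \<open>
  Throughout, \<open>\<C>\<close> is the class of labeled graphs under consideration and \<open>c\<close> the exponent of the
  range of identities.
\<close>

definition instances :: "('v inst \<Rightarrow> bool) \<Rightarrow> nat \<Rightarrow> 'v inst set" where
  "instances \<C> c = {I. \<C> I \<and> identity_assignment c I}"

type_synonym 'v prover = "'v inst \<Rightarrow> 'v \<Rightarrow> bool list"
type_synonym verifier = "view \<Rightarrow> bool"

definition is_pls ::
  "('v inst \<Rightarrow> bool) \<Rightarrow> nat \<Rightarrow> ('v inst \<Rightarrow> bool) \<Rightarrow> nat \<Rightarrow> 'v prover \<Rightarrow> verifier \<Rightarrow> bool" where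
  "is_pls \<C> c P r p vf \<longleftrightarrow>
     (\<forall>I \<in> instances \<C> c. P I \<longrightarrow> (\<forall>v \<in> verts I. vf (local_view I (p I) r v))) \<and>
     (\<forall>I \<in> instances \<C> c. \<not> P I \<longrightarrow> (\<forall>cert. \<exists>v \<in> verts I. \<not> vf (local_view I cert r v)))"

definition pls_size ::
  "('v inst \<Rightarrow> bool) \<Rightarrow> nat \<Rightarrow> ('v inst \<Rightarrow> bool) \<Rightarrow> 'v prover \<Rightarrow> nat \<Rightarrow> enat" where
  "pls_size \<C> c P p n =
     (SUP I \<in> {I \<in> instances \<C> c. P I \<and> card (verts I) = n}. SUP v \<in> verts I. enat (length (p I v)))"

text \<open>The value is \<open>\<infinity>\<close> if there is no scheme at all.\<close>

definition size_pls ::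
  "('v inst \<Rightarrow> bool) \<Rightarrow> nat \<Rightarrow> ('v inst \<Rightarrow> bool) \<Rightarrow> nat \<Rightarrow> nat \<Rightarrow> enat" where
  "size_pls \<C> c P t n =
     (INF p \<in> {p. \<exists>r\<le>t. \<exists>vf. is_pls \<C> c P r p vf}. pls_size \<C> c P p n)"

text \<open>
  \<^term>\<open>size_pls\<close> is a minimum for each \<open>n\<close> separately. That it is bounded by a function \<open>f\<close> of \<open>n\<close> is
  understood here in the strong sense: one scheme achieves the bound for all \<open>n\<close> simultaneously
  (and hence so does the minimum for each \<open>n\<close>).
\<close>

definition size_pls_bounded ::
  "('v inst \<Rightarrow> bool) \<Rightarrow> nat \<Rightarrow> ('v inst \<Rightarrow> bool) \<Rightarrow> nat \<Rightarrow> (nat \<Rightarrow> nat) \<Rightarrow> bool" where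
  "size_pls_bounded \<C> c P t f \<longleftrightarrow>
     (\<exists>r\<le>t. \<exists>p vf. is_pls \<C> c P r p vf \<and> (\<forall>n. pls_size \<C> c P p n \<le> enat (f n))) \<and>
     (\<forall>n. size_pls \<C> c P t n \<le> enat (f n))"

end

(* Cut the graph into blocks of side about L = t/10 and mark two adjacent layers along each boundary.
   A block of s nodes contains O(s/L) marked nodes, so their radius-1 certificates, O(s k / L) bits
   in total, can be spread evenly over the block at O(k/t) bits per node. All other certificates
   need not be stored: every node sees its whole block and searches for certificates of the unmarked
   nodes that make everyone nearby accept. A separator two layers thick decouples the searches of
   different blocks. The blocks are recognised by two bits of colour, and identities order the
   chunks within a block. *)

theory Submission
  imports Defs
begin

section \<open>Balls and views\<close>

text \<open>A cheating prover may choose colours, marks and chunks at will, and the new verifier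
  does not check that they describe blocks of any kind. Soundness is proved for an arbitrary
  decoder: whatever the decoded values are, local acceptance yields certificates for the whole graph
  that the original verifier accepts. Blocks matter only for completeness and for the size bound.
  Constants: a block has internal diameter at most \<open>4 * L\<close>. A node guesses within
  distance \<open>4 * L\<close>, needs the decoded values two steps further, and each decoding looks
  \<open>4 * L\<close> around, so a radius of \<open>8 * L + 2\<close> suffices. With
  \<open>L = t div 10\<close> this fits once \<open>t \<ge> 10\<close>; for smaller \<open>t\<close>
  the original scheme is within a constant factor of the bound. The factor 243 is 3 + 12 * 20: three
  header bits; 12 from the density 4 / L of marked nodes times 3 * k bits per encoded certificate;
  20 from \<open>t \<le> 20 * L\<close>. When \<open>k n = 0\<close> the bound is 0, so even the
  header bits are too many and the certificates must be empty.\<close>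

definition reach :: "('a \<times> 'a) set \<Rightarrow> nat \<Rightarrow> 'a \<Rightarrow> 'a set" where
  "reach E r x = {y. \<exists>k\<le>r. (x, y) \<in> E ^^ k}"

lemma dist_ball_reach: "dist_ball I r v = reach (adj I) r v"
  by (simp add: dist_ball_def reach_def)

lemma reach_refl [simp]: "x \<in> reach E r x"
  by (auto simp: reach_def intro!: exI[of _ 0])

lemma reach_trans:
  assumes "y \<in> reach E r x" "z \<in> reach E s y"
  shows "z \<in> reach E (r + s) x"
proof -
  obtain k l where kl: "k \<le> r" "l \<le> s" "(x, y) \<in> E ^^ k" "(y, z) \<in> E ^^ l"
    using assms by (auto simp: reach_def)
  then have "(x, z) \<in> E ^^ (k + l)"
    by (auto simp: relpow_add)
  then show ?thesis
    using kl by (auto simp: reach_def intro!: exI[of _ "k + l"])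
qed

lemma reach_mono: "r \<le> s \<Longrightarrow> reach E r x \<subseteq> reach E s x"
  by (auto simp: reach_def intro: order_trans)

lemma sym_relpow: "sym E \<Longrightarrow> (x, y) \<in> E ^^ k \<Longrightarrow> (y, x) \<in> E ^^ k"
proof (induction k arbitrary: y)
  case (Suc k)
  then obtain z where z: "(x, z) \<in> E ^^ k" "(z, y) \<in> E"
    by auto
  then show ?case
    using Suc symD relpow_Suc_I2 by metis
qed auto

lemma reach_sym:
  assumes "sym E" "y \<in> reach E r x"
  shows "x \<in> reach E r y"
  using assms sym_relpow[of E x y] by (auto simp: reach_def)

lemma reach_mono_rel:
  assumes "E \<subseteq> F"
  shows "reach E r x \<subseteq> reach F r x"
proof -
  have "(x, y) \<in> E ^^ k \<Longrightarrow> (x, y) \<in> F ^^ k" for y k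
    using assms by (induction k arbitrary: y) auto
  then show ?thesis
    by (auto simp: reach_def)
qed

lemma reach_verts:
  assumes "E \<subseteq> V \<times> V" "x \<in> V"
  shows "reach E r x \<subseteq> V"
proof -
  have "(x, y) \<in> E ^^ k \<Longrightarrow> y \<in> V" for k y
    using assms by (cases k) auto
  then show ?thesis
    by (auto simp: reach_def)
qed

section \<open>Simulating small views inside a large one\<close>

definition wf_inst :: "'v inst \<Rightarrow> bool" where
  "wf_inst I \<longleftrightarrow> finite (verts I) \<and> adj I \<subseteq> verts I \<times> verts I \<and> sym (adj I) \<and>
     inj_on (ident I) (verts I)"

definition subview :: "view \<Rightarrow> nat \<Rightarrow> nat \<Rightarrow> view" where
  "subview V r i =
     \<lparr>view_center = i,
      view_nodes = {x \<in> view_nodes V. fst x \<in> reach (view_adj V) r i},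
      view_adj = {(a, b) \<in> view_adj V.
        \<exists>k<r. a \<in> reach (view_adj V) k i \<or> b \<in> reach (view_adj V) k i}\<rparr>"

definition recert :: "(nat \<Rightarrow> bool list) \<Rightarrow> view \<Rightarrow> view" where
  "recert h V = V\<lparr>view_nodes := (\<lambda>(i, l, c). (i, l, h i)) ` view_nodes V\<rparr>"

lemma recert_local_view:
  "recert h (local_view I cert r u) = local_view I (\<lambda>w. h (ident I w)) r u"
  by (force simp: recert_def local_view_def image_def)

lemma local_view_cong:
  assumes "\<And>w. w \<in> dist_ball I r u \<Longrightarrow> cert w = cert' w"
  shows "local_view I cert r u = local_view I cert' r u"
  using assms by (force simp: local_view_def)

lemma local_view_simps [simp]:
  "view_center (local_view I cert r v) = ident I v"
  "view_nodes (local_view I cert r v) =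
     {(ident I u, label I u, cert u) | u. u \<in> dist_ball I r v}"
  "view_adj (local_view I cert r v) = {(ident I u, ident I w) | u w.
        (u, w) \<in> adj I \<and> (\<exists>k<r. u \<in> dist_ball I k v \<or> w \<in> dist_ball I k v)}"
  by (simp_all add: local_view_def)

text \<open>Injective identities let a walk on names be lifted step by step to a walk on vertices.
  Conversely, a walk of length at most \<open>r\<close> from \<open>u\<close> uses only edges that
  are still visible from \<open>v\<close>.\<close>

lemma reach_local_view:
  assumes wf: "wf_inst I" and v: "v \<in> verts I" and u: "u \<in> dist_ball I d v" and t: "d + r \<le> t"
  shows "reach (view_adj (local_view I cert t v)) r (ident I u) = ident I ` dist_ball I r u"
    (is "reach ?A r _ = _")
proof (intro equalityI subsetI)
  have sub: "adj I \<subseteq> verts I \<times> verts I" and inj: "inj_on (ident I) (verts I)"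
    using wf by (auto simp: wf_inst_def)
  have uV: "u \<in> verts I"
    using u v reach_verts[OF sub] by (auto simp: dist_ball_reach)
  have lift: "(ident I u, j) \<in> ?A ^^ k \<Longrightarrow> \<exists>w. j = ident I w \<and> (u, w) \<in> adj I ^^ k" for k j
  proof (induction k arbitrary: j)
    case 0
    then show ?case by auto
  next
    case (Suc k)
    then obtain j' where j': "(ident I u, j') \<in> ?A ^^ k" "(j', j) \<in> ?A"
      by auto
    obtain w where w: "j' = ident I w" "(u, w) \<in> adj I ^^ k"
      using Suc.IH[OF j'(1)] by auto
    have wV: "w \<in> verts I"
      using w(2) uV sub by (cases k) auto
    obtain x y where xy: "j' = ident I x" "j = ident I y" "(x, y) \<in> adj I"
      using j'(2) by auto
    have "x = w"
      using xy w wV sub inj by (auto dest: inj_onD)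
    then show ?case
      using xy w by auto
  qed
  show "j \<in> ident I ` dist_ball I r u" if "j \<in> reach ?A r (ident I u)" for j
    using that lift unfolding reach_def dist_ball_def by blast
  have push: "(ident I u, ident I w) \<in> ?A ^^ k" if "(u, w) \<in> adj I ^^ k" "k \<le> r" for k w
    using that
  proof (induction k arbitrary: w)
    case 0
    then show ?case by auto
  next
    case (Suc k)
    then obtain x where x: "(u, x) \<in> adj I ^^ k" "(x, w) \<in> adj I"
      by auto
    have "x \<in> reach (adj I) k u"
      using x by (auto simp: reach_def)
    then have "x \<in> dist_ball I (d + k) v"
      using u reach_trans by (fastforce simp: dist_ball_reach)
    \<comment> \<open>Strictness matters: the view contains an edge only if one of its ends is at
      distance less than \<open>t\<close>.\<close>
    moreover have "d + k < t"
      using Suc.prems t by simp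
    ultimately have "(ident I x, ident I w) \<in> ?A"
      using x by auto
    then show ?case
      using Suc.IH[OF x(1)] Suc.prems by auto
  qed
  show "j \<in> reach ?A r (ident I u)" if "j \<in> ident I ` dist_ball I r u" for j
    using that push unfolding reach_def dist_ball_def by blast
qed

text \<open>A node can run any radius-\<open>r\<close> computation on behalf of a node at distance
  \<open>d\<close>: all that the latter sees lies within \<open>d + r\<close> of \<open>v\<close>,
  and an edge with an end closer than \<open>r\<close> to \<open>u\<close> has an end closer than
  \<open>t\<close> to \<open>v\<close>.\<close>

lemma subview_local_view:
  assumes wf: "wf_inst I" and v: "v \<in> verts I" and u: "u \<in> dist_ball I d v" and t: "d + r \<le> t"
  shows "subview (local_view I cert t v) r (ident I u) = local_view I cert r u"
proof -
  let ?V = "local_view I cert t v"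
  have sub: "adj I \<subseteq> verts I \<times> verts I" and inj: "inj_on (ident I) (verts I)"
    using wf by (auto simp: wf_inst_def)
  have ballV: "dist_ball I s v \<subseteq> verts I" for s
    using v reach_verts[OF sub] by (auto simp: dist_ball_reach)
  then have uV: "u \<in> verts I" using u by auto
  have ballu: "dist_ball I s u \<subseteq> verts I" for s
    using uV reach_verts[OF sub] by (auto simp: dist_ball_reach)
  have mem: "ident I w \<in> ident I ` dist_ball I s u \<longleftrightarrow> w \<in> dist_ball I s u" if "w \<in> verts I" for w s
    using that ballu[of s] inj by (auto dest: inj_onD)
  have re: "reach (view_adj ?V) s (ident I u) = ident I ` dist_ball I s u" if "s \<le> r" for s
    using reach_local_view[OF wf v u, of s t] that t by simp
  have far: "w \<in> dist_ball I (d + s) v" if "w \<in> dist_ball I s u" for w s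
    using u that reach_trans by (fastforce simp: dist_ball_reach)
  have sub_t: "dist_ball I s u \<subseteq> dist_ball I t v" if "s \<le> r" for s
    using far reach_mono[of "d + s" t "adj I" v] that t by (fastforce simp: dist_ball_reach)
  have "ident I w \<in> ident I ` dist_ball I r u \<longleftrightarrow> w \<in> dist_ball I r u"
    if "w \<in> dist_ball I t v" for w
    using mem ballV that by blast
  then have nodes: "{x \<in> view_nodes ?V. fst x \<in> reach (view_adj ?V) r (ident I u)} =
      view_nodes (local_view I cert r u)"
    unfolding re[OF order_refl] unfolding local_view_simps(2)
    using sub_t[OF order_refl] by fastforce
  have edge: "(\<exists>k<r. a \<in> reach (view_adj ?V) k (ident I u) \<or> b \<in> reach (view_adj ?V) k (ident I u))
      \<longleftrightarrow> (\<exists>k<r. a \<in> ident I ` dist_ball I k u \<or> b \<in> ident I ` dist_ball I k u)" for a b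
    using re by (metis less_imp_le)
  have near: "\<exists>k<t. x \<in> dist_ball I k v \<or> y \<in> dist_ball I k v"
    if "k < r" "x \<in> dist_ball I k u \<or> y \<in> dist_ball I k u" for k x y
    using that far t by (intro exI[of _ "d + k"]) auto
  have adjs: "{(a, b) \<in> view_adj ?V.
        \<exists>k<r. a \<in> reach (view_adj ?V) k (ident I u) \<or> b \<in> reach (view_adj ?V) k (ident I u)} =
      view_adj (local_view I cert r u)" (is "?L = ?R")
  proof (intro equalityI subsetI)
    fix e assume "e \<in> ?L"
    then obtain a b where ab: "e = (a, b)" "(a, b) \<in> view_adj ?V"
        "\<exists>k<r. a \<in> ident I ` dist_ball I k u \<or> b \<in> ident I ` dist_ball I k u"
      unfolding edge by blast
    moreover obtain x y where xy: "a = ident I x" "b = ident I y" "(x, y) \<in> adj I"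
      using ab(2) by auto
    moreover have "x \<in> verts I" "y \<in> verts I"
      using xy(3) sub by auto
    ultimately have "\<exists>k<r. x \<in> dist_ball I k u \<or> y \<in> dist_ball I k u"
      by (simp only: mem)
    then show "e \<in> ?R"
      using xy ab(1) by auto
  next
    fix e assume "e \<in> ?R"
    then obtain x y k where xy: "e = (ident I x, ident I y)" "(x, y) \<in> adj I"
        "k < r" "x \<in> dist_ball I k u \<or> y \<in> dist_ball I k u"
      by auto
    then have "e \<in> view_adj ?V"
      using near[OF xy(3,4)] by auto
    moreover have "\<exists>k<r. ident I x \<in> ident I ` dist_ball I k u \<or>
        ident I y \<in> ident I ` dist_ball I k u"
      using xy by blast
    ultimately show "e \<in> ?L"
      unfolding edge xy(1) by auto
  qed
  show ?thesis
    unfolding subview_def nodes adjs by (simp add: local_view_def)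
qed

section \<open>Guessing the certificates between separators\<close>

text \<open>A decoder yields the certificate of the centre of a view of radius \<open>R\<close>, or \<^term>\<open>None\<close> if that
  certificate has to be guessed. The set \<open>K\<close> is closed under steps of length two between guessed
  nodes, because the radius-1 view of a node then meets at most one such set: guesses made
  independently for distinct sets never have to agree.\<close>

definition guess_verifier :: "verifier \<Rightarrow> (view \<Rightarrow> bool list option) \<Rightarrow> nat \<Rightarrow> verifier" where
  "guess_verifier vf dec R V \<longleftrightarrow>
     (\<exists>K g. K \<subseteq> reach (view_adj V) R (view_center V) \<and>
       (dec (subview V R (view_center V)) = None \<longrightarrow> view_center V \<in> K) \<and>
       (\<forall>i\<in>K. \<forall>j\<in>reach (view_adj V) 2 i. dec (subview V R j) = None \<longrightarrow> j \<in> K) \<and>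
       (\<forall>i\<in>insert (view_center V) (\<Union>i\<in>K. reach (view_adj V) 1 i).
         vf (recert (\<lambda>j. case dec (subview V R j) of None \<Rightarrow> g j | Some x \<Rightarrow> x) (subview V 1 i))))"

text \<open>Restates acceptance in terms of vertices, so that later arguments need not mention
  names. The radius is forced by the closure condition: it decodes nodes up to distance
  \<open>R + 2\<close> from \<open>v\<close>, each with a view of radius \<open>R\<close>.\<close>

lemma guess_verifier_iff:
  fixes cert dec
  assumes wf: "wf_inst I" and v: "v \<in> verts I" and t: "2 * R + 2 \<le> t"
  defines "D \<equiv> \<lambda>u. dec (local_view I cert R u)"
  shows "guess_verifier vf dec R (local_view I cert t v) \<longleftrightarrow>
    (\<exists>K g. K \<subseteq> dist_ball I R v \<and> (D v = None \<longrightarrow> v \<in> K) \<and>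
       (\<forall>u\<in>K. \<forall>w\<in>dist_ball I 2 u. D w = None \<longrightarrow> w \<in> K) \<and>
       (\<forall>u\<in>insert v (\<Union>u\<in>K. dist_ball I 1 u).
         vf (local_view I (\<lambda>w. case D w of None \<Rightarrow> g w | Some x \<Rightarrow> x) 1 u)))"
    (is "_ \<longleftrightarrow> ?rhs")
proof -
  let ?V = "local_view I cert t v"
  let ?id = "ident I"
  have sub: "adj I \<subseteq> verts I \<times> verts I" and inj: "inj_on ?id (verts I)"
    using wf by (auto simp: wf_inst_def)
  have ballV: "dist_ball I s u \<subseteq> verts I" if "u \<in> verts I" for s u
    using that reach_verts[OF sub] by (auto simp: dist_ball_reach)
  have far: "w \<in> dist_ball I (r + s) v" if "u \<in> dist_ball I r v" "w \<in> dist_ball I s u" for u w r s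
    using that reach_trans by (fastforce simp: dist_ball_reach)
  have v0: "v \<in> dist_ball I s v" for s
    by (simp add: dist_ball_reach)
  have Dec: "dec (subview ?V R (?id u)) = D u" if "u \<in> dist_ball I (R + 2) v" for u
    using subview_local_view[OF wf v that, of R t] t by (simp add: D_def)
  have near: "dist_ball I s v \<subseteq> dist_ball I (R + 2) v" if "s \<le> R + 2" for s
    using reach_mono[OF that] by (simp add: dist_ball_reach)
  have R2: "reach (view_adj ?V) s (?id u) = ?id ` dist_ball I s u"
    if "u \<in> dist_ball I R v" "s \<le> 2" for u s
    using reach_local_view[OF wf v that(1), of s t] that t by simp
  have RR: "reach (view_adj ?V) R (?id v) = ?id ` dist_ball I R v"
    using reach_local_view[OF wf v v0[of 0], of R t] t by simp
  have S: "recert (\<lambda>j. case dec (subview ?V R j) of None \<Rightarrow> g j | Some x \<Rightarrow> x) (subview ?V 1 (?id u))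
      = local_view I (\<lambda>w. case D w of None \<Rightarrow> g (?id w) | Some x \<Rightarrow> x) 1 u"
    if "u \<in> dist_ball I (R + 1) v" for g u
  proof -
    have "subview ?V 1 (?id u) = local_view I cert 1 u"
      using subview_local_view[OF wf v that, of 1 t] t by simp
    moreover have "w \<in> dist_ball I (R + 2) v" if "w \<in> dist_ball I 1 u" for w
      using far[OF \<open>u \<in> dist_ball I (R + 1) v\<close> that] by (simp add: numeral_2_eq_2)
    ultimately show ?thesis
      by (auto simp only: recert_local_view Dec intro!: local_view_cong)
  qed
  show ?thesis
  proof
    assume "guess_verifier vf dec R ?V"
    then obtain K g where K: "K \<subseteq> ?id ` dist_ball I R v"
      and vK: "D v = None \<longrightarrow> ?id v \<in> K"
      and cl: "\<forall>i\<in>K. \<forall>j\<in>reach (view_adj ?V) 2 i. dec (subview ?V R j) = None \<longrightarrow> j \<in> K"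
      and acc: "\<forall>i\<in>insert (?id v) (\<Union>i\<in>K. reach (view_adj ?V) 1 i).
         vf (recert (\<lambda>j. case dec (subview ?V R j) of None \<Rightarrow> g j | Some x \<Rightarrow> x) (subview ?V 1 i))"
      unfolding guess_verifier_def local_view_simps(1) RR Dec[OF v0] by (elim exE conjE) (rule that)
    let ?K = "{u \<in> dist_ball I R v. ?id u \<in> K}"
    have v': "D v = None \<longrightarrow> v \<in> ?K"
      using vK v0 by auto
    have cl': "w \<in> ?K" if "u \<in> ?K" "w \<in> dist_ball I 2 u" "D w = None" for u w
    proof -
      have "w \<in> dist_ball I (R + 2) v"
        using that far by blast
      then have "?id w \<in> K"
        using cl[rule_format, of "?id u" "?id w"] that R2[of u 2] Dec by auto
      then obtain w' where "?id w' = ?id w" "w' \<in> dist_ball I R v"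
        using K by auto
      then have "w' = w"
        using inj ballV[OF v] \<open>w \<in> dist_ball I (R + 2) v\<close> by (metis inj_onD subsetD)
      then show ?thesis
        using \<open>?id w \<in> K\<close> \<open>w' \<in> dist_ball I R v\<close> by auto
    qed
    have acc': "vf (local_view I (\<lambda>w. case D w of None \<Rightarrow> g (?id w) | Some x \<Rightarrow> x) 1 u)"
      if u: "u \<in> insert v (\<Union>u\<in>?K. dist_ball I 1 u)" for u
    proof -
      have "u \<in> dist_ball I (R + 1) v"
        using u v0 far[of _ R u 1] by blast
      note S = S[OF this]
      have "?id u \<in> insert (?id v) (\<Union>i\<in>K. reach (view_adj ?V) 1 i)"
        using u R2[of _ 1] by auto
      from bspec[OF acc this] show ?thesis
        unfolding S .
    qed
    show ?rhs
    proof (rule exI[of _ ?K], rule exI[of _ "\<lambda>w. g (?id w)"], intro conjI)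
      show "D v = None \<longrightarrow> v \<in> ?K"
        by (rule v')
      show "\<forall>u\<in>?K. \<forall>w\<in>dist_ball I 2 u. D w = None \<longrightarrow> w \<in> ?K"
        by (intro ballI impI) (rule cl')
      show "\<forall>u\<in>insert v (\<Union>u\<in>?K. dist_ball I 1 u).
          vf (local_view I (\<lambda>w. case D w of None \<Rightarrow> g (?id w) | Some x \<Rightarrow> x) 1 u)"
        by (intro ballI acc')
    qed blast
  next
    assume ?rhs
    then obtain K g where K: "K \<subseteq> dist_ball I R v"
      and vK: "D v = None \<longrightarrow> v \<in> K"
      and cl: "\<forall>u\<in>K. \<forall>w\<in>dist_ball I 2 u. D w = None \<longrightarrow> w \<in> K"
      and acc: "\<forall>u\<in>insert v (\<Union>u\<in>K. dist_ball I 1 u).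
         vf (local_view I (\<lambda>w. case D w of None \<Rightarrow> g w | Some x \<Rightarrow> x) 1 u)"
      by (elim exE conjE) (rule that)
    define g' where "g' = (\<lambda>i. g (inv_into (verts I) ?id i))"
    have g': "g' (?id w) = g w" if "w \<in> verts I" for w
      using that inj by (simp add: g'_def)
    have cl': "j \<in> ?id ` K"
      if i: "i \<in> ?id ` K" and j: "j \<in> reach (view_adj ?V) 2 i" "dec (subview ?V R j) = None" for i j
    proof -
      obtain u where u: "i = ?id u" "u \<in> K"
        using i by auto
      then obtain w where w: "j = ?id w" "w \<in> dist_ball I 2 u"
        using j R2[of u 2] K by auto
      then show ?thesis
        using j cl u K Dec[of w] far[of u R w 2] by auto
    qed
    have acc': "vf (recert (\<lambda>j. case dec (subview ?V R j) of None \<Rightarrow> g' j | Some x \<Rightarrow> x) (subview ?V 1 i))"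
      if i: "i \<in> insert (?id v) (\<Union>i\<in>?id ` K. reach (view_adj ?V) 1 i)" for i
    proof -
      have "reach (view_adj ?V) 1 (?id x) = ?id ` dist_ball I 1 x" if "x \<in> K" for x
        using R2[of x 1] K that by auto
      then obtain u where u: "i = ?id u" "u \<in> insert v (\<Union>u\<in>K. dist_ball I 1 u)"
        using i by (auto simp del: local_view_simps)
      then have u': "u \<in> dist_ball I (R + 1) v"
        using v0 K far[of _ R u 1] by blast
      then have "u \<in> verts I"
        using ballV[OF v] by auto
      then have "local_view I (\<lambda>w. case D w of None \<Rightarrow> g' (?id w) | Some x \<Rightarrow> x) 1 u =
          local_view I (\<lambda>w. case D w of None \<Rightarrow> g w | Some x \<Rightarrow> x) 1 u"
        using ballV[of u 1] g' by (intro local_view_cong) (auto split: option.split)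
      then show ?thesis
        unfolding u(1) S[OF u'] using bspec[OF acc u(2)] by simp
    qed
    show "guess_verifier vf dec R ?V"
      unfolding guess_verifier_def local_view_simps(1) RR Dec[OF v0]
    proof (rule exI[of _ "?id ` K"], rule exI[of _ g'], intro conjI)
      show "?id ` K \<subseteq> ?id ` dist_ball I R v"
        using K by (rule image_mono)
      show "D v = None \<longrightarrow> ?id v \<in> ?id ` K"
        using vK by simp
      show "\<forall>i\<in>?id ` K. \<forall>j\<in>reach (view_adj ?V) 2 i. dec (subview ?V R j) = None \<longrightarrow> j \<in> ?id ` K"
        by (intro ballI impI) (rule cl')
      show "\<forall>i\<in>insert (?id v) (\<Union>i\<in>?id ` K. reach (view_adj ?V) 1 i).
         vf (recert (\<lambda>j. case dec (subview ?V R j) of None \<Rightarrow> g' j | Some x \<Rightarrow> x) (subview ?V 1 i))"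
        by (intro ballI) (rule acc')
    qed
  qed
qed

text \<open>The certificates are glued from the guesses of different nodes. Join undecoded nodes at
  distance at most two; on each component use the guess of one representative, whose closed set
  \<open>K\<close> contains the whole component. Every radius-1 ball meets at most one component, so
  each node sees exactly the certificates of a single accepted guess.\<close>

lemma guess_verifier_sound:
  assumes wf: "wf_inst I" and t: "2 * R + 2 \<le> t"
    and acc: "\<And>v. v \<in> verts I \<Longrightarrow> guess_verifier vf dec R (local_view I cert t v)"
  shows "\<exists>cert'. \<forall>v\<in>verts I. vf (local_view I cert' 1 v)"
proof -
  define D where "D = (\<lambda>u. dec (local_view I cert R u))"
  have sub: "adj I \<subseteq> verts I \<times> verts I" and sy: "sym (adj I)"
    using wf by (auto simp: wf_inst_def)
  define Q where "Q = (\<lambda>v K g. (D v = None \<longrightarrow> v \<in> K) \<and>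
       (\<forall>u\<in>K. \<forall>w\<in>dist_ball I 2 u. D w = None \<longrightarrow> w \<in> K) \<and>
       (\<forall>u\<in>insert v (\<Union>u\<in>K. dist_ball I 1 u).
         vf (local_view I (\<lambda>w. case D w of None \<Rightarrow> g w | Some x \<Rightarrow> x) 1 u)))"
  have "\<exists>K g. Q v K g" if v: "v \<in> verts I" for v
    using acc[OF v, unfolded guess_verifier_iff[OF wf v t]] unfolding D_def Q_def
    by (elim exE conjE) (intro exI conjI; assumption)
  then obtain K g where Q: "\<And>v. v \<in> verts I \<Longrightarrow> Q v (K v) (g v)"
    by metis
  have vK: "v \<in> K v" if "v \<in> verts I" "D v = None" for v
    using Q that by (simp add: Q_def)
  have cl: "w \<in> K v" if "v \<in> verts I" "u \<in> K v" "w \<in> dist_ball I 2 u" "D w = None" for v u w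
    using Q[OF that(1)] that unfolding Q_def by blast
  have ok: "vf (local_view I (\<lambda>w. case D w of None \<Rightarrow> g v w | Some x \<Rightarrow> x) 1 u)"
    if "v \<in> verts I" "u \<in> insert v (\<Union>u\<in>K v. dist_ball I 1 u)" for v u
    using Q[OF that(1)] that(2) unfolding Q_def by blast
  define E where "E = {(u, w). D u = None \<and> D w = None \<and> w \<in> dist_ball I 2 u}"
  have symE: "sym E"
    using reach_sym[OF sy] by (auto simp: sym_def E_def dist_ball_reach)
  \<comment> \<open>The choice depends only on the set of nodes reachable by \<open>E\<close>. As
    \<open>E\<close> is symmetric, this set is the same throughout a component, and so is the
    representative.\<close>
  define rep where "rep = (\<lambda>u. SOME x. (u, x) \<in> E\<^sup>*)"
  have rep: "(u, rep u) \<in> E\<^sup>*" for u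
    unfolding rep_def by (rule someI[of _ u]) auto
  have rep_eq: "rep u = rep w" if "(u, w) \<in> E" for u w
  proof -
    have "(u, x) \<in> E\<^sup>* \<longleftrightarrow> (w, x) \<in> E\<^sup>*" for x
      using that symD[OF symE that] by (meson converse_rtrancl_into_rtrancl)
    then show ?thesis
      by (simp add: rep_def)
  qed
  have EV: "x \<in> verts I" if "(u, x) \<in> E\<^sup>*" "u \<in> verts I" for u x
    using that
    by (induction rule: rtrancl_induct)
      (use reach_verts[OF sub] in \<open>auto simp: E_def dist_ball_reach\<close>)
  have clE: "x \<in> K r" if "(r, x) \<in> E\<^sup>*" "r \<in> verts I" "D r = None" for r x
    using that by (induction rule: rtrancl_induct) (auto simp: E_def intro: vK cl)
  have inK: "u \<in> K (rep u)" if "u \<in> verts I" "D u = None" for u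
  proof -
    have "(rep u, u) \<in> E\<^sup>*"
      using rep symE by (meson sym_rtrancl symD)
    moreover have "rep u \<in> verts I"
      using EV rep that by blast
    moreover have "D (rep u) = None"
      using rep[of u] that by (cases rule: rtranclE) (auto simp: E_def)
    ultimately show ?thesis
      by (rule clE)
  qed
  let ?c = "\<lambda>w. case D w of None \<Rightarrow> g (rep w) w | Some x \<Rightarrow> x"
  have "vf (local_view I ?c 1 v)" if v: "v \<in> verts I" for v
  proof (cases "\<exists>u\<in>dist_ball I 1 v. D u = None")
    case True
    then obtain u where u: "u \<in> dist_ball I 1 v" "D u = None"
      by auto
    have uV: "u \<in> verts I"
      using u v reach_verts[OF sub] by (auto simp: dist_ball_reach)
    \<comment> \<open>Two undecoded nodes in the ball around \<open>v\<close> are at distance at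
      most two, through \<open>v\<close>.\<close>
    have "rep w = rep u" if "w \<in> dist_ball I 1 v" "D w = None" for w
    proof (rule rep_eq)
      have "v \<in> reach (adj I) 1 w"
        using that reach_sym[OF sy] by (auto simp: dist_ball_reach)
      then have "u \<in> reach (adj I) (1 + 1) w"
        using u reach_trans by (fastforce simp: dist_ball_reach)
      then show "(w, u) \<in> E"
        using that u by (auto simp: E_def dist_ball_reach numeral_2_eq_2)
    qed
    then have "local_view I ?c 1 v =
        local_view I (\<lambda>w. case D w of None \<Rightarrow> g (rep u) w | Some x \<Rightarrow> x) 1 v"
      by (intro local_view_cong) (auto split: option.split)
    \<comment> \<open>The representative has checked all neighbours of its set \<open>K\<close> too,
      and hence \<open>v\<close>, even if \<open>v\<close> itself is decoded.\<close>
    moreover have "v \<in> dist_ball I 1 u"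
      using u reach_sym[OF sy] by (auto simp: dist_ball_reach)
    ultimately show ?thesis
      using ok[of "rep u" v] EV[OF rep uV] inK[OF uV u(2)] by auto
  next
    case False
    then have "local_view I ?c 1 v =
        local_view I (\<lambda>w. case D w of None \<Rightarrow> g v w | Some x \<Rightarrow> x) 1 v"
      by (intro local_view_cong) (auto split: option.split)
    then show ?thesis
      using ok[OF v, of v] by simp
  qed
  then show ?thesis
    by blast
qed

section \<open>Distributing certificates over blocks\<close>

text \<open>A prefix-free code: \<open>True\<close> announces a further bit and \<open>False\<close>
  ends the word. Concatenated words can thus be separated without storing their lengths.\<close>

definition enc :: "bool list \<Rightarrow> bool list" where
  "enc c = concat (map (\<lambda>b. [True, b]) c) @ [False]"

lemma length_enc: "length (enc c) = 2 * length c + 1"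
  by (induction c) (auto simp: enc_def)

lemma enc_append_inj: "enc c @ xs = enc d @ ys \<Longrightarrow> c = d \<and> xs = ys"
proof (induction c arbitrary: d)
  case Nil
  then show ?case by (cases d) (auto simp: enc_def)
next
  case (Cons b c)
  then show ?case by (cases d) (auto simp: enc_def)
qed

lemma concat_enc_inj:
  "concat (map (\<lambda>i. enc (f i)) xs) = concat (map (\<lambda>i. enc (g i)) xs) \<Longrightarrow> i \<in> set xs \<Longrightarrow> f i = g i"
  by (induction xs) (auto dest: enc_append_inj)

lemma length_concat_enc:
  "(\<And>i. i \<in> set xs \<Longrightarrow> length (f i) \<le> k) \<Longrightarrow>
     length (concat (map (\<lambda>i. enc (f i)) xs)) \<le> length xs * (2 * k + 1)"
proof (induction xs)
  case (Cons x xs)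
  have "length (f x) \<le> k"
    using Cons.prems by simp
  moreover have "length (concat (map (\<lambda>i. enc (f i)) xs)) \<le> length xs * (2 * k + 1)"
    using Cons by simp
  ultimately show ?case
    by (simp add: length_enc)
qed simp

lemma chunks_exist:
  "distinct ys \<Longrightarrow> length s \<le> length ys * m \<Longrightarrow>
     \<exists>g. concat (map g ys) = s \<and> (\<forall>y. length (g y) \<le> m)"
proof (induction ys arbitrary: s)
  case Nil
  then show ?case by (intro exI[of _ "\<lambda>_. []"]) auto
next
  case (Cons y ys)
  have "length (drop m s) \<le> length ys * m"
    using Cons.prems by simp
  then obtain g where g: "concat (map g ys) = drop m s" "\<forall>y. length (g y) \<le> m"
    using Cons by fastforce
  \<comment> \<open>By distinctness \<open>y\<close> does not occur in \<open>ys\<close>, so setting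
    its chunk leaves the others intact.\<close>
  have "map (g(y := take m s)) ys = map g ys"
    using Cons.prems by auto
  then have "concat (map (g(y := take m s)) (y # ys)) = s"
    using g(1) by (simp del: map_eq_conv)
  moreover have "\<forall>z. length ((g(y := take m s)) z) \<le> m"
    using g(2) by simp
  ultimately show ?case
    by blast
qed

section \<open>Reading blocks and stored certificates off a view\<close>

definition view_cert :: "view \<Rightarrow> nat \<Rightarrow> bool list" where
  "view_cert V i = (SOME c. \<exists>l. (i, l, c) \<in> view_nodes V)"

lemma view_cert_local_view:
  assumes "wf_inst I" "u \<in> verts I" "w \<in> dist_ball I r u"
  shows "view_cert (local_view I cert r u) (ident I w) = cert w"
proof -
  have "dist_ball I r u \<subseteq> verts I" and "inj_on (ident I) (verts I)"
    using assms reach_verts[of "adj I" "verts I" u] by (auto simp: wf_inst_def dist_ball_reach)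
  then have "(\<exists>l. (ident I w, l, c) \<in> view_nodes (local_view I cert r u)) \<longleftrightarrow> c = cert w" for c
    using assms(3) by (auto dest: inj_onD)
  then show ?thesis
    by (simp add: view_cert_def)
qed

text \<open>A nonempty certificate consists of two colour bits, a mark and a chunk. Neighbours are in the
  same block iff they have the same colour; the chunks of a block, ordered by identity, form the
  encoded certificates of its marked nodes. Empty certificates stand for themselves: they occur
  when the original scheme has size 0.\<close>

definition mono_adj :: "view \<Rightarrow> (nat \<times> nat) set" where
  "mono_adj V = {(i, j) \<in> view_adj V. take 2 (view_cert V i) = take 2 (view_cert V j)}"

definition block_ids :: "view \<Rightarrow> nat set" where
  "block_ids V = (mono_adj V)\<^sup>* `` {view_center V}"

text \<open>The choice of \<open>f\<close> inverts the encoding: since the code is prefix-free,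
  \<open>f\<close> is determined on the marked identities of the block, and the centre is one of
  them in this branch. On malformed chunks the value is arbitrary, which is harmless because
  soundness holds for every decoder.\<close>

definition decoder :: "view \<Rightarrow> bool list option" where
  "decoder V =
     (if view_cert V (view_center V) = [] then Some []
      else if \<not> view_cert V (view_center V) ! 2 then None
      else Some ((SOME f.
        concat (map (\<lambda>i. enc (f i)) (sorted_list_of_set {i \<in> block_ids V. view_cert V i ! 2})) =
        concat (map (\<lambda>i. drop 3 (view_cert V i)) (sorted_list_of_set (block_ids V))))
          (view_center V)))"

text \<open>In order: colours tell adjacent blocks apart; a block is explored along its own edges
  within radius \<open>4 * L\<close>; marked nodes have density at most 4 / L in each block;
  unmarked nodes within two steps share a block. The last condition is what decouples the guesses.
  Both factors 4 come from the grid, where the factor 2 of an interval occurs once per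
  coordinate.\<close>

definition blocking ::
  "'v set \<Rightarrow> ('v \<times> 'v) set \<Rightarrow> nat \<Rightarrow> ('v \<Rightarrow> 'b) \<Rightarrow> ('v \<Rightarrow> bool \<times> bool) \<Rightarrow> ('v \<Rightarrow> bool) \<Rightarrow> bool" where
  "blocking V E L blk col mk \<longleftrightarrow>
     (\<forall>(u, w) \<in> E. blk u = blk w \<longleftrightarrow> col u = col w) \<and>
     (\<forall>u \<in> V. \<forall>w \<in> V. blk u = blk w \<longrightarrow>
        w \<in> reach {(x, y) \<in> E. blk x = blk y} (4 * L) u) \<and>
     (\<forall>u \<in> V. card {w \<in> V. blk w = blk u \<and> mk w} * L
        \<le> 4 * card {w \<in> V. blk w = blk u}) \<and>
     (\<forall>u \<in> V. \<forall>w \<in> reach E 2 u. \<not> mk u \<longrightarrow> \<not> mk w \<longrightarrow> blk u = blk w)"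

text \<open>Monochromatic walks never leave a block, however long they are, because adjacent nodes
  of distinct blocks differ in colour. Conversely, each node of the block is reached by a walk
  inside it that is short enough to be visible.\<close>

lemma block_ids_local_view:
  assumes wf: "wf_inst I" and bl: "blocking (verts I) (adj I) L blk col mk" and v: "v \<in> verts I"
    and cert: "\<And>w. w \<in> verts I \<Longrightarrow> take 2 (cert w) = [fst (col w), snd (col w)]"
  shows "block_ids (local_view I cert (4 * L) v) = ident I ` {w \<in> verts I. blk w = blk v}"
proof (intro equalityI subsetI)
  let ?V = "local_view I cert (4 * L) v"
  have sub: "adj I \<subseteq> verts I \<times> verts I" and inj: "inj_on (ident I) (verts I)" and sy: "sym (adj I)"
    using wf by (auto simp: wf_inst_def)
  have ballV: "dist_ball I s v \<subseteq> verts I" for s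
    using v reach_verts[OF sub] by (auto simp: dist_ball_reach)
  have ball_step: "y \<in> dist_ball I (Suc k) v" if "x \<in> dist_ball I k v" "(x, y) \<in> adj I" for x y k
  proof -
    have "y \<in> reach (adj I) 1 x"
      using that by (auto simp: reach_def intro!: exI[of _ 1])
    then show ?thesis
      using that reach_trans[of x "adj I" k v y 1] by (simp add: dist_ball_reach)
  qed
  have mono: "blk x = blk y \<longleftrightarrow> take 2 (view_cert ?V (ident I x)) = take 2 (view_cert ?V (ident I y))"
    if "(x, y) \<in> adj I" "x \<in> dist_ball I (4 * L) v" "y \<in> dist_ball I (4 * L) v" for x y
  proof -
    have "blk x = blk y \<longleftrightarrow> col x = col y"
      using bl that(1) by (auto simp: blocking_def)
    moreover have "x \<in> verts I" "y \<in> verts I"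
      using sub that by auto
    ultimately show ?thesis
      using that by (simp add: view_cert_local_view[OF wf v] cert prod_eq_iff)
  qed
  show "j \<in> ident I ` {w \<in> verts I. blk w = blk v}" if "j \<in> block_ids ?V" for j
  proof -
    have "(ident I v, j) \<in> (mono_adj ?V)\<^sup>*"
      using that by (simp add: block_ids_def)
    then show ?thesis
    proof (induction rule: rtrancl_induct)
      case base
      then show ?case using v by auto
    next
      case (step i j)
      then obtain w where w: "i = ident I w" "w \<in> verts I" "blk w = blk v"
        by auto
      obtain x y k where xy: "i = ident I x" "j = ident I y" "(x, y) \<in> adj I" "k < 4 * L"
          "x \<in> dist_ball I k v \<or> y \<in> dist_ball I k v"
        using step(2) by (auto simp: mono_adj_def)
      have yV: "x \<in> verts I" "y \<in> verts I"
        using xy sub by auto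
      then have "x = w"
        using xy w inj by (auto dest: inj_onD)
      \<comment> \<open>A visible edge has one end at distance less than \<open>4 * L\<close>, so
        both ends lie in the ball and their colours can be read.\<close>
      have "dist_ball I k v \<union> dist_ball I (Suc k) v \<subseteq> dist_ball I (4 * L) v"
        using reach_mono[of k "4 * L"] reach_mono[of "Suc k" "4 * L"] xy(4)
        unfolding dist_ball_reach by (meson Suc_leI Un_least less_imp_le)
      moreover have "{x, y} \<subseteq> dist_ball I k v \<union> dist_ball I (Suc k) v"
        using xy(5) ball_step xy(3) symD[OF sy xy(3)] by blast
      ultimately have "blk x = blk y"
        using mono[OF xy(3)] step(2) xy(1,2) by (auto simp: mono_adj_def)
      then show ?case
        using xy yV w \<open>x = w\<close> by auto
    qed
  qed
  have path: "(ident I v, ident I w) \<in> (mono_adj ?V)\<^sup>* \<and> w \<in> dist_ball I k v"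
    if "(v, w) \<in> {(x, y) \<in> adj I. blk x = blk y} ^^ k" "k \<le> 4 * L" for w k
    using that
  proof (induction k arbitrary: w)
    case 0
    then show ?case by (auto simp: dist_ball_reach)
  next
    case (Suc k)
    then obtain x where x: "(v, x) \<in> {(x, y) \<in> adj I. blk x = blk y} ^^ k" "(x, w) \<in> adj I"
        "blk x = blk w"
      by auto
    then have IH: "(ident I v, ident I x) \<in> (mono_adj ?V)\<^sup>*" "x \<in> dist_ball I k v"
      using Suc by auto
    have w: "w \<in> dist_ball I (Suc k) v"
      using ball_step IH(2) x(2) .
    have "k < 4 * L"
      using Suc.prems(2) by simp
    then have "(ident I x, ident I w) \<in> view_adj ?V"
      unfolding local_view_simps(3) using IH(2) x(2) by blast
    moreover have "x \<in> dist_ball I (4 * L) v" "w \<in> dist_ball I (4 * L) v"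
      using IH(2) w reach_mono[of k "4 * L"] reach_mono[OF Suc.prems(2)] \<open>k < 4 * L\<close>
      unfolding dist_ball_reach by (meson less_imp_le subsetD)+
    ultimately have "(ident I x, ident I w) \<in> mono_adj ?V"
      using mono x by (simp add: mono_adj_def del: local_view_simps)
    then show ?case
      using IH w by auto
  qed
  show "j \<in> block_ids ?V" if j: "j \<in> ident I ` {w \<in> verts I. blk w = blk v}" for j
  proof -
    obtain w where w: "j = ident I w" "w \<in> verts I" "blk v = blk w"
      using j by auto
    have "w \<in> reach {(x, y) \<in> adj I. blk x = blk y} (4 * L) v"
      using bl v w unfolding blocking_def by blast
    then obtain k where "k \<le> 4 * L" "(v, w) \<in> {(x, y) \<in> adj I. blk x = blk y} ^^ k"
      unfolding reach_def by blast
    then show ?thesis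
      using path w by (simp add: block_ids_def del: local_view_simps(3))
  qed
qed

text \<open>A block of s nodes has at most 4 * s / L marked ones, each contributing at most 2 * k +
  1 \<le> 3 * k bits. The total is at most 12 * k * s / L, hence at most m * s, so every node of the
  block stores at most \<open>m\<close> of these bits behind its three header bits.\<close>

lemma blocking_encode:
  assumes wf: "wf_inst I" and bl: "blocking (verts I) (adj I) L blk col mk" and L: "L \<ge> 1" and k: "k \<ge> 1"
    and q: "\<And>v. v \<in> verts I \<Longrightarrow> length (q v) \<le> k" and m: "12 * k \<le> L * m"
  shows "\<exists>cert. \<forall>v\<in>verts I. length (cert v) \<le> 3 + m \<and>
    decoder (local_view I cert (4 * L) v) = (if mk v then Some (q v) else None)"
proof -
  let ?id = "ident I"
  have fin: "finite (verts I)" and inj: "inj_on ?id (verts I)"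
    using wf by (auto simp: wf_inst_def)
  define q' where "q' = (\<lambda>i. q (inv_into (verts I) ?id i))"
  have q': "q' (?id w) = q w" if "w \<in> verts I" for w
    using that inj by (simp add: q'_def)
  define B where "B = (\<lambda>b. {w \<in> verts I. blk w = b})"
  define ys where "ys = (\<lambda>b. sorted_list_of_set (?id ` B b))"
  define xs where "xs = (\<lambda>b. sorted_list_of_set (?id ` {w \<in> B b. mk w}))"
  have finB: "finite (B b)" for b
    using fin by (simp add: B_def)
  have injB: "inj_on ?id (B b)" for b
    using inj by (rule inj_on_subset) (auto simp: B_def)
  have len: "length (concat (map (\<lambda>i. enc (q' i)) (xs b))) \<le> length (ys b) * m" for b
  proof (cases "B b = {}")
    case False
    then obtain u where u: "u \<in> verts I" "blk u = b"
      by (auto simp: B_def)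
    have lx: "length (xs b) = card {w \<in> B b. mk w}"
      unfolding xs_def length_sorted_list_of_set
      using injB by (intro card_image) (auto intro: inj_on_subset)
    have ly: "length (ys b) = card (B b)"
      unfolding ys_def length_sorted_list_of_set using injB by (rule card_image)
    have "{w \<in> B b. mk w} = {w \<in> verts I. blk w = blk u \<and> mk w}"
      using u by (auto simp: B_def)
    then have 1: "length (xs b) * L \<le> 4 * length (ys b)"
      using bl u by (auto simp: blocking_def lx ly B_def)
    have "length (concat (map (\<lambda>i. enc (q' i)) (xs b))) \<le> length (xs b) * (2 * k + 1)"
    proof (rule length_concat_enc)
      fix i assume "i \<in> set (xs b)"
      moreover have "finite (?id ` {w \<in> B b. mk w})"
        using finB[of b] by simp
      ultimately show "length (q' i) \<le> k"
        using q q' by (auto simp: xs_def B_def)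
    qed
    also have "\<dots> \<le> length (xs b) * (3 * k)"
      using k by (intro mult_le_mono) auto
    finally have "L * length (concat (map (\<lambda>i. enc (q' i)) (xs b))) \<le> (length (xs b) * L) * (3 * k)"
      by (metis mult.assoc mult.commute mult_le_mono2)
    also have "\<dots> \<le> (4 * length (ys b)) * (3 * k)"
      using 1 by (rule mult_le_mono1)
    also have "\<dots> = length (ys b) * (12 * k)"
      by simp
    also have "\<dots> \<le> length (ys b) * (L * m)"
      using m by (rule mult_le_mono2)
    also have "\<dots> = L * (length (ys b) * m)"
      by simp
    finally show ?thesis
      using L by simp
  qed (auto simp: xs_def)
  have "\<forall>b. \<exists>g. concat (map g (ys b)) = concat (map (\<lambda>i. enc (q' i)) (xs b)) \<and> (\<forall>y. length (g y) \<le> m)"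
    using chunks_exist[OF _ len] by (auto simp: ys_def)
  then obtain G where G: "\<And>b. concat (map (G b) (ys b)) = concat (map (\<lambda>i. enc (q' i)) (xs b))"
      "\<And>b y. length (G b y) \<le> m"
    by metis
  define cert where "cert = (\<lambda>w. [fst (col w), snd (col w), mk w] @ G (blk w) (?id w))"
  have "decoder (local_view I cert (4 * L) v) = (if mk v then Some (q v) else None)"
    if v: "v \<in> verts I" for v
  proof -
    let ?V = "local_view I cert (4 * L) v"
    have bi: "block_ids ?V = ?id ` B (blk v)"
      unfolding B_def using block_ids_local_view[OF wf bl v] by (simp add: cert_def)
    have vc: "view_cert ?V (?id w) = cert w" if "w \<in> B (blk v)" for w
    proof (rule view_cert_local_view[OF wf v])
      have "w \<in> reach {(x, y) \<in> adj I. blk x = blk y} (4 * L) v"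
        using that v bl by (auto simp: blocking_def B_def)
      then show "w \<in> dist_ball I (4 * L) v"
        using reach_mono_rel[of "{(x, y) \<in> adj I. blk x = blk y}" "adj I"]
        by (auto simp: dist_ball_reach)
    qed
    have vB: "v \<in> B (blk v)"
      using v by (simp add: B_def)
    have "{i \<in> block_ids ?V. view_cert ?V i ! 2} = ?id ` {w \<in> B (blk v). mk w}"
      unfolding bi using vc by (auto simp: cert_def)
    then have X: "sorted_list_of_set {i \<in> block_ids ?V. view_cert ?V i ! 2} = xs (blk v)"
      by (simp add: xs_def)
    have chunks: "map (\<lambda>i. drop 3 (view_cert ?V i)) (ys (blk v)) = map (G (blk v)) (ys (blk v))"
      using finB vc by (auto simp: ys_def cert_def B_def)
    have ids: "sorted_list_of_set (block_ids ?V) = ys (blk v)"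
      by (simp add: bi ys_def)
    have Y: "concat (map (\<lambda>i. drop 3 (view_cert ?V i)) (sorted_list_of_set (block_ids ?V))) =
        concat (map (\<lambda>i. enc (q' i)) (xs (blk v)))"
      unfolding ids chunks by (rule G(1))
    define f where "f = (SOME f. concat (map (\<lambda>i. enc (f i)) (xs (blk v))) =
        concat (map (\<lambda>i. enc (q' i)) (xs (blk v))))"
    have f: "concat (map (\<lambda>i. enc (f i)) (xs (blk v))) = concat (map (\<lambda>i. enc (q' i)) (xs (blk v)))"
      unfolding f_def by (rule someI[of _ q']) simp
    have "f (?id v) = q v" if "mk v"
    proof -
      have "?id v \<in> set (xs (blk v))"
        using that vB finB by (simp add: xs_def)
      then show ?thesis
        using concat_enc_inj[OF f] q'[OF v] by simp
    qed
    moreover have "decoder ?V = (if mk v then Some (f (?id v)) else None)"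
      unfolding decoder_def X Y f_def[symmetric] local_view_simps(1) vc[OF vB]
      by (simp add: cert_def)
    ultimately show ?thesis
      by simp
  qed
  moreover have "length (cert v) \<le> 3 + m" for v
    using G(2) by (simp add: cert_def)
  ultimately show ?thesis
    by blast
qed

section \<open>Completeness and the size bound\<close>

lemma guess_verifier_complete:
  assumes wf: "wf_inst I" and bl: "blocking (verts I) (adj I) L blk col mk" and v: "v \<in> verts I"
    and t: "8 * L + 2 \<le> t"
    and dec: "\<And>u. u \<in> verts I \<Longrightarrow>
      dec (local_view I cert (4 * L) u) = (if mk u then Some (q u) else None)"
    and acc: "\<And>u. u \<in> verts I \<Longrightarrow> vf (local_view I q 1 u)"
  shows "guess_verifier vf dec (4 * L) (local_view I cert t v)"
proof -
  define D where "D = (\<lambda>u. dec (local_view I cert (4 * L) u))"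
  have D: "D u = (if mk u then Some (q u) else None)" if "u \<in> verts I" for u
    using dec[OF that] by (simp add: D_def)
  have sub: "adj I \<subseteq> verts I \<times> verts I"
    using wf by (auto simp: wf_inst_def)
  have ballV: "dist_ball I s u \<subseteq> verts I" if "u \<in> verts I" for s u
    using that reach_verts[OF sub] by (auto simp: dist_ball_reach)
  \<comment> \<open>If \<open>v\<close> is marked there is nothing to guess and \<open>K\<close> is
    empty. Otherwise \<open>K\<close> is the unmarked part of its block, closed under two-step moves
    by the separator condition. The guess itself will be the original certificate
    \<open>q\<close>.\<close>
  define K where "K = {w \<in> verts I. blk w = blk v \<and> \<not> mk w \<and> \<not> mk v}"
  have "K \<subseteq> dist_ball I (4 * L) v"
  proof
    fix w assume "w \<in> K"
    then have "w \<in> reach {(x, y) \<in> adj I. blk x = blk y} (4 * L) v"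
      using v bl by (auto simp: blocking_def K_def)
    then show "w \<in> dist_ball I (4 * L) v"
      using reach_mono_rel[of "{(x, y) \<in> adj I. blk x = blk y}" "adj I"]
      by (auto simp: dist_ball_reach)
  qed
  moreover have "D v = None \<longrightarrow> v \<in> K"
    using v D by (auto simp: K_def)
  moreover have "w \<in> K" if "u \<in> K" "w \<in> dist_ball I 2 u" "D w = None" for u w
  proof -
    have "w \<in> verts I"
      using that ballV by (auto simp: K_def)
    moreover from this have "\<not> mk w"
      using D[of w] that by (auto split: if_splits)
    moreover have "blk u = blk w"
      using bl that \<open>\<not> mk w\<close> unfolding blocking_def K_def dist_ball_reach by blast
    ultimately show ?thesis
      using that by (auto simp: K_def)
  qed
  moreover have "vf (local_view I (\<lambda>w. case D w of None \<Rightarrow> q w | Some x \<Rightarrow> x) 1 u)"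
    if "u \<in> insert v (\<Union>u\<in>K. dist_ball I 1 u)" for u
  proof -
    have u: "u \<in> verts I"
      using that v ballV by (auto simp: K_def)
    have "local_view I (\<lambda>w. case D w of None \<Rightarrow> q w | Some x \<Rightarrow> x) 1 u = local_view I q 1 u"
      using ballV[OF u, of 1] D by (intro local_view_cong) auto
    then show ?thesis
      using acc[OF u] by simp
  qed
  ultimately have "\<exists>K g. K \<subseteq> dist_ball I (4 * L) v \<and> (D v = None \<longrightarrow> v \<in> K) \<and>
       (\<forall>u\<in>K. \<forall>w\<in>dist_ball I 2 u. D w = None \<longrightarrow> w \<in> K) \<and>
       (\<forall>u\<in>insert v (\<Union>u\<in>K. dist_ball I 1 u).
         vf (local_view I (\<lambda>w. case D w of None \<Rightarrow> g w | Some x \<Rightarrow> x) 1 u))"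
    by (intro exI[of _ K] exI[of _ q] conjI ballI) auto
  then show ?thesis
    using guess_verifier_iff[OF wf v, of "4 * L" t vf dec cert] t unfolding D_def by simp
qed

lemma size_pls_bounded_by_blocking:
  fixes P :: "'v inst \<Rightarrow> bool" and k :: "nat \<Rightarrow> nat"
  assumes wf: "\<And>I. I \<in> instances \<C> c \<Longrightarrow> wf_inst I"
    and bl: "\<And>I L. I \<in> instances \<C> c \<Longrightarrow> L \<ge> 1 \<Longrightarrow>
      \<exists>(blk :: 'v \<Rightarrow> nat \<times> nat) col mk. blocking (verts I) (adj I) L blk col mk"
    and p: "is_pls \<C> c P 1 p vf" and size: "\<And>n. pls_size \<C> c P p n = enat (k n)"
    and t: "t \<ge> 1"
  shows "size_pls_bounded \<C> c P t (\<lambda>n. 243 * nat \<lceil>real (k n) / real t\<rceil>)"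
proof -
  define m where "m = (\<lambda>n. nat \<lceil>real (k n) / real t\<rceil>)"
  have m: "k n \<le> t * m n" for n
  proof -
    have "real (k n) / real t \<le> real (m n)"
      unfolding m_def by linarith
    then have "real (k n) \<le> real (t * m n)"
      using t by (simp add: field_simps)
    then show ?thesis
      by linarith
  qed
  have len: "length (p I v) \<le> k (card (verts I))"
    if "I \<in> instances \<C> c" "P I" "v \<in> verts I" for I v
  proof -
    have "enat (length (p I v)) \<le> pls_size \<C> c P p (card (verts I))"
      unfolding pls_size_def using that by (auto intro!: SUP_upper2[of I] SUP_upper2[of v])
    then show ?thesis
      by (simp add: size)
  qed
  have pos: "vf (local_view I (p I) 1 v)" if "I \<in> instances \<C> c" "P I" "v \<in> verts I" for I v
    using p that by (auto simp: is_pls_def)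
  have neg: "P I" if "I \<in> instances \<C> c" "\<forall>v\<in>verts I. vf (local_view I cert 1 v)" for I cert
    using p that unfolding is_pls_def by blast
  have "\<exists>r\<le>t. \<exists>p vf. is_pls \<C> c P r p vf \<and> (\<forall>n. pls_size \<C> c P p n \<le> enat (243 * m n))"
  proof (cases "t < 10")
    case True
    have "k n \<le> 243 * m n" for n
      using m[of n] mult_le_mono1[of t 243 "m n"] True by linarith
    then show ?thesis
      using t p size by (intro exI[of _ 1] exI[of _ p] exI[of _ vf] conjI) auto
  next
    case False
    \<comment> \<open>With \<open>t \<ge> 10\<close> one has \<open>L \<ge> 1\<close>, hence 8 * L +
      2 \<le> 10 * L \<le> t, and t < 10 * L + 10 \<le> 20 * L.\<close>
    define L where "L = t div 10"
    have L: "L \<ge> 1" "8 * L + 2 \<le> t" "t \<le> 20 * L"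
      using False unfolding L_def by presburger+
    have mL: "12 * k n \<le> L * (240 * m n)" for n
      using m[of n] mult_le_mono1[OF L(3), of "m n"] by linarith
    have t4: "2 * (4 * L) + 2 \<le> t"
      using L(2) by simp
    let ?V = "guess_verifier vf decoder (4 * L)"
    have "\<exists>cert. \<forall>v\<in>verts I. length (cert v) \<le> 243 * m (card (verts I)) \<and>
        ?V (local_view I cert t v)" if I: "I \<in> instances \<C> c" "P I" for I
    proof (cases "k (card (verts I)) = 0")
      case True
      \<comment> \<open>Here the original certificates are empty as well, and \<open>decoder\<close>
        returns an empty certificate unchanged, so no node has to guess.\<close>
      have D: "decoder (local_view I (\<lambda>_. []) (4 * L) v) = Some []" if "v \<in> verts I" for v
      proof -
        have "v \<in> dist_ball I (4 * L) v"
          by (simp add: dist_ball_reach)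
        then have "view_cert (local_view I (\<lambda>_. []) (4 * L) v) (ident I v) = []"
          using view_cert_local_view[OF wf[OF I(1)] that] by blast
        then show ?thesis
          by (simp add: decoder_def del: local_view_simps(2,3))
      qed
      have "?V (local_view I (\<lambda>_. []) t v)" if v: "v \<in> verts I" for v
      proof -
        have "dist_ball I 1 v \<subseteq> verts I"
          using wf[OF I(1)] v reach_verts[of "adj I" "verts I"]
          by (auto simp: wf_inst_def dist_ball_reach)
        then have "local_view I (\<lambda>w. case decoder (local_view I (\<lambda>_. []) (4 * L) w) of
            None \<Rightarrow> [] | Some x \<Rightarrow> x) 1 v = local_view I (p I) 1 v"
          using D len[OF I] True by (intro local_view_cong) auto
        then show ?thesis
          unfolding guess_verifier_iff[OF wf[OF I(1)] v t4]
          using pos[OF I v] D[OF v] by (intro exI[of _ "{}"] exI[of _ "\<lambda>_. []"]) simp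
      qed
      then show ?thesis
        by (intro exI[of _ "\<lambda>_. []"]) auto
    next
      case False
      then have k: "k (card (verts I)) \<ge> 1"
        by simp
      \<comment> \<open>This lets the three header bits be absorbed: 3 + 240 * m \<le> 243 *
        m.\<close>
      have m1: "m (card (verts I)) \<ge> 1"
        using k m[of "card (verts I)"] by (cases "m (card (verts I))") auto
      obtain blk :: "'v \<Rightarrow> nat \<times> nat" and col mk where blk: "blocking (verts I) (adj I) L blk col mk"
        using bl[OF I(1) L(1)] by blast
      obtain cert where cert: "\<And>v. v \<in> verts I \<Longrightarrow> length (cert v) \<le> 3 + 240 * m (card (verts I))"
          "\<And>v. v \<in> verts I \<Longrightarrow>
            decoder (local_view I cert (4 * L) v) = (if mk v then Some (p I v) else None)"
        using blocking_encode[where q = "p I", OF wf[OF I(1)] blk L(1) k len[OF I] mL] by blast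
      have "?V (local_view I cert t v)" if "v \<in> verts I" for v
        using guess_verifier_complete[where q = "p I" and dec = decoder and cert = cert and vf = vf,
          OF wf[OF I(1)] blk that L(2) cert(2) pos[OF I]] .
      then show ?thesis
        using cert(1) m1 by (intro exI[of _ cert]) fastforce
    qed
    then obtain p' where p': "\<And>I v. I \<in> instances \<C> c \<Longrightarrow> P I \<Longrightarrow> v \<in> verts I \<Longrightarrow>
        length (p' I v) \<le> 243 * m (card (verts I)) \<and> ?V (local_view I (p' I) t v)"
      by metis
    have "is_pls \<C> c P t p' ?V"
    proof -
      have "\<exists>v\<in>verts I. \<not> ?V (local_view I cert t v)"
        if "I \<in> instances \<C> c" "\<not> P I" for I cert
      proof (rule ccontr)
        assume "\<not> ?thesis"
        then have "\<exists>cert'. \<forall>v\<in>verts I. vf (local_view I cert' 1 v)"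
          using L(2) by (intro guess_verifier_sound[OF wf[OF that(1)], where t = t]) auto
        then show False
          using neg that by blast
      qed
      then show ?thesis
        using p' by (auto simp: is_pls_def)
    qed
    moreover have "pls_size \<C> c P p' n \<le> enat (243 * m n)" for n
      unfolding pls_size_def using p' by (auto intro!: SUP_least)
    ultimately show ?thesis
      by blast
  qed
  then obtain r p' vf' where r: "r \<le> t" "is_pls \<C> c P r p' vf'"
      "\<And>n. pls_size \<C> c P p' n \<le> enat (243 * m n)"
    by blast
  have "size_pls \<C> c P t n \<le> enat (243 * m n)" for n
    unfolding size_pls_def using r by (intro INF_lower2[of p']) auto
  with r show ?thesis
    unfolding size_pls_bounded_def m_def by blast
qed

section \<open>Blocks of an interval\<close>

text \<open>The interval \<open>{..<n}\<close> is cut into blocks of length \<open>L\<close>; the last one absorbs the remainder,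
  so that no block is shorter than \<open>L\<close> unless it is the whole interval.\<close>

definition bidx :: "nat \<Rightarrow> nat \<Rightarrow> nat \<Rightarrow> nat" where
  "bidx n L i = min (i div L) (n div L - 1)"

text \<open>Marks the first two positions of each block. An interval shorter than \<open>L\<close>
  is a single block and stays unmarked, since two marks could exceed the density 2 / L
  there.\<close>

definition bstart :: "nat \<Rightarrow> nat \<Rightarrow> nat \<Rightarrow> bool" where
  "bstart n L i \<longleftrightarrow> L \<le> n \<and> i < bidx n L i * L + 2"

lemma bidx_mono: "i \<le> j \<Longrightarrow> bidx n L i \<le> bidx n L j"
  unfolding bidx_def using div_le_mono[of i j L] by linarith

lemma bidx_Suc: "L \<ge> 1 \<Longrightarrow> bidx n L (Suc i) \<le> Suc (bidx n L i)"
proof -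
  assume "L \<ge> 1"
  then have "Suc i div L \<le> (i + L) div L"
    by (intro div_le_mono) simp
  also have "\<dots> = Suc (i div L)"
    using \<open>L \<ge> 1\<close> by simp
  finally show ?thesis
    by (simp add: bidx_def min_def)
qed

lemma bidx_lower: "bidx n L i * L \<le> i"
proof -
  have "bidx n L i * L \<le> i div L * L"
    by (intro mult_le_mono1) (simp add: bidx_def)
  also have "\<dots> \<le> i"
    by simp
  finally show ?thesis .
qed

text \<open>Ordinary blocks have length \<open>L\<close>. The last one ends before
  \<open>Suc (n div L) * L\<close>, which lies \<open>2 * L\<close> beyond its start when
  \<open>n div L > 0\<close>.\<close>

lemma bidx_upper:
  assumes "L \<ge> 1" "i < n"
  shows "i < bidx n L i * L + 2 * L"
proof (cases "i div L \<le> n div L - 1")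
  case True
  have "i < Suc (i div L) * L"
    using assms(1) by (simp add: dividend_less_div_times)
  then show ?thesis
    using True assms(1) by (simp add: bidx_def)
next
  case False
  have "n < Suc (n div L) * L"
    using assms(1) by (simp add: dividend_less_div_times)
  then show ?thesis
    using False assms(2) by (cases "n div L") (auto simp: bidx_def)
qed

lemma bidx_geI: "L \<ge> 1 \<Longrightarrow> b \<le> n div L - 1 \<Longrightarrow> b * L \<le> i \<Longrightarrow> b \<le> bidx n L i"
  by (simp add: bidx_def less_eq_div_iff_mult_less_eq)

lemma bidx_eq:
  assumes L: "L \<ge> 1" and b: "b \<le> n div L - 1" "b * L \<le> i" "i < b * L + L"
  shows "bidx n L i = b"
proof -
  have "i div L < Suc b"
    using L b(3) by (simp add: div_less_iff_less_mult add.commute)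
  then show ?thesis
    using bidx_geI[OF L b(1,2)] by (simp add: bidx_def)
qed

text \<open>If a block boundary separated \<open>i\<close> from \<open>j\<close>, the block of
  \<open>j\<close> would start after \<open>i\<close>, so \<open>j\<close> would be among its first
  two positions and marked. Marking one side of each boundary is therefore enough.\<close>

lemma bidx_close:
  assumes L: "L \<ge> 1" and ij: "i \<le> j" "j \<le> i + 2" and mk: "\<not> bstart n L j"
  shows "bidx n L i = bidx n L j"
proof (rule ccontr)
  assume "bidx n L i \<noteq> bidx n L j"
  then have less: "bidx n L i < bidx n L j"
    using bidx_mono[OF ij(1), of n L] by simp
  then have "\<not> bidx n L j * L \<le> i"
    using bidx_geI[OF L, of "bidx n L j" n i] by (auto simp: bidx_def)
  then have "j < bidx n L j * L + 2"
    using ij by linarith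
  moreover have "L \<le> n"
    using less by (cases "n < L") (auto simp: bidx_def)
  ultimately show False
    using mk by (simp add: bstart_def)
qed

lemma card_bstart:
  assumes L: "L \<ge> 1" and i: "i < n"
  shows "card {j. j < n \<and> bidx n L j = bidx n L i \<and> bstart n L j} * L
    \<le> 2 * card {j. j < n \<and> bidx n L j = bidx n L i}"
proof (cases "L \<le> n")
  case True
  let ?b = "bidx n L i"
  have b: "?b \<le> n div L - 1"
    by (simp add: bidx_def)
  have "?b * L + L \<le> n"
  proof -
    have "Suc ?b \<le> n div L"
      using b True L by (cases "n div L") (auto simp: div_eq_0_iff)
    then have "Suc ?b * L \<le> n div L * L"
      by (rule mult_le_mono1)
    also have "\<dots> \<le> n"
      by simp
    finally show ?thesis
      by (simp add: add.commute)
  qed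
  then have "{?b * L..<?b * L + L} \<subseteq> {j. j < n \<and> bidx n L j = ?b}"
    using bidx_eq[OF L b] by auto
  then have "card {?b * L..<?b * L + L} \<le> card {j. j < n \<and> bidx n L j = ?b}"
    by (intro card_mono) auto
  then have 1: "L \<le> card {j. j < n \<and> bidx n L j = ?b}"
    by simp
  have "{j. j < n \<and> bidx n L j = ?b \<and> bstart n L j} \<subseteq> {?b * L..<?b * L + 2}"
  proof
    fix j assume "j \<in> {j. j < n \<and> bidx n L j = ?b \<and> bstart n L j}"
    then show "j \<in> {?b * L..<?b * L + 2}"
      using bidx_lower[of n L j] by (auto simp: bstart_def)
  qed
  then have "card {j. j < n \<and> bidx n L j = ?b \<and> bstart n L j} \<le> card {?b * L..<?b * L + 2}"
    by (intro card_mono) auto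
  then have "card {j. j < n \<and> bidx n L j = ?b \<and> bstart n L j} \<le> 2"
    by simp
  then show ?thesis
    using 1 by (intro mult_le_mono)
qed (simp add: bstart_def)

text \<open>Monotonicity of \<open>bidx\<close> makes blocks intervals, so the direct walk between
  two members stays inside; its length is below \<open>2 * L\<close>. The map \<open>h\<close>
  embeds the interval as a cycle, a row or a column.\<close>

lemma reach_bidx:
  assumes L: "L \<ge> 1" and sy: "sym E" and ij: "i < n" "j < n" "bidx n L i = bidx n L j"
    and step: "\<And>x. Suc x < n \<Longrightarrow> bidx n L x = bidx n L i \<Longrightarrow> bidx n L (Suc x) = bidx n L i \<Longrightarrow>
      (h x, h (Suc x)) \<in> E"
  shows "h j \<in> reach E (2 * L) (h i)"
proof -
  have path: "h y \<in> reach E (2 * L) (h x)"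
    if xy: "x \<le> y" "y < n" "bidx n L x = bidx n L i" "bidx n L y = bidx n L i" for x y
  proof -
    have "(h x, h (x + d)) \<in> E ^^ d" if "x + d \<le> y" for d
      using that
    proof (induction d)
      case (Suc d)
      have "bidx n L (x + d) = bidx n L i" "bidx n L (Suc (x + d)) = bidx n L i"
        using bidx_mono[of x "x + d" n L] bidx_mono[of "x + d" y n L]
          bidx_mono[of x "Suc (x + d)" n L] bidx_mono[of "Suc (x + d)" y n L] xy Suc.prems by auto
      then have "(h (x + d), h (Suc (x + d))) \<in> E"
        using step xy Suc.prems by auto
      then show ?case
        using Suc by auto
    qed auto
    from this[of "y - x"] have "(h x, h y) \<in> E ^^ (y - x)"
      using xy by simp
    moreover have "y - x \<le> 2 * L"
      using bidx_lower[of n L x] bidx_upper[OF L xy(2)] xy by simp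
    ultimately show ?thesis
      by (auto simp: reach_def)
  qed
  show ?thesis
  proof (cases "i \<le> j")
    case True
    then show ?thesis
      using path ij by simp
  next
    case False
    then have "h i \<in> reach E (2 * L) (h j)"
      using path ij by simp
    then show ?thesis
      using reach_sym[OF sy] by blast
  qed
qed

section \<open>Blocks of cycles and grids\<close>

lemma reach_map:
  assumes "\<And>x y. (x, y) \<in> E \<Longrightarrow> (h x, h y) \<in> F" "y \<in> reach E r x"
  shows "h y \<in> reach F r (h x)"
proof -
  have "(x, y) \<in> E ^^ k \<Longrightarrow> (h x, h y) \<in> F ^^ k" for k
    by (induction k arbitrary: y) (auto intro: assms(1))
  then show ?thesis
    using assms(2) by (auto simp: reach_def)
qed

lemma reach_2: "y \<in> reach E 2 x \<longleftrightarrow> y = x \<or> (x, y) \<in> E \<or> (\<exists>z. (x, z) \<in> E \<and> (z, y) \<in> E)"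
proof -
  have "(\<exists>k\<le>2. Q k) \<longleftrightarrow> Q 0 \<or> Q 1 \<or> Q 2" for Q :: "nat \<Rightarrow> bool"
    by (auto simp: numeral_2_eq_2 le_Suc_eq)
  then show ?thesis
    unfolding reach_def by (auto simp: numeral_2_eq_2)
qed

lemma blocking_iso:
  assumes f: "bij_betw f V W" and E: "E \<subseteq> V \<times> V" and F: "F \<subseteq> W \<times> W"
    and iso: "\<forall>u\<in>V. \<forall>v\<in>V. (u, v) \<in> E \<longleftrightarrow> (f u, f v) \<in> F"
    and bl: "blocking W F L blk col mk"
  shows "blocking V E L (\<lambda>v. blk (f v)) (\<lambda>v. col (f v)) (\<lambda>v. mk (f v))"
proof -
  define g where "g = inv_into V f"
  have fW: "f u \<in> W" if "u \<in> V" for u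
    using f that by (auto simp: bij_betw_def)
  have gf: "g (f u) = u" if "u \<in> V" for u
    using f that by (simp add: g_def bij_betw_def)
  have fg: "f (g x) = x" "g x \<in> V" if "x \<in> W" for x
    using f that by (simp_all add: g_def bij_betw_def f_inv_into_f inv_into_into)
  have gE: "(g x, g y) \<in> E" if "(x, y) \<in> F" for x y
  proof -
    have "x \<in> W" "y \<in> W"
      using F that by auto
    then show ?thesis
      using iso fg that by simp
  qed
  have fE: "(f u, f v) \<in> F" if "(u, v) \<in> E" for u v
    using iso E that by blast
  have card: "card {w \<in> V. Q (f w)} = card {y \<in> W. Q y}" for Q
  proof (rule bij_betw_same_card[of f])
    show "bij_betw f {w \<in> V. Q (f w)} {y \<in> W. Q y}"
      using f by (auto simp: bij_betw_def inj_on_def)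
  qed
  show ?thesis
    unfolding blocking_def
  proof (intro conjI ballI impI)
    fix u w assume uw: "u \<in> V" "w \<in> V" "blk (f u) = blk (f w)"
    then have "f w \<in> reach {(x, y) \<in> F. blk x = blk y} (4 * L) (f u)"
      using bl fW by (simp add: blocking_def)
    then have "g (f w) \<in> reach {(x, y) \<in> E. blk (f x) = blk (f y)} (4 * L) (g (f u))"
    proof (rule reach_map[rotated])
      fix x y assume xy: "(x, y) \<in> {(x, y) \<in> F. blk x = blk y}"
      then have "x \<in> W" "y \<in> W"
        using F by auto
      then show "(g x, g y) \<in> {(x, y) \<in> E. blk (f x) = blk (f y)}"
        using xy gE fg by auto
    qed
    then show "w \<in> reach {(x, y) \<in> E. blk (f x) = blk (f y)} (4 * L) u"
      using gf uw by simp
  next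
    fix u assume "u \<in> V"
    then show "card {w \<in> V. blk (f w) = blk (f u) \<and> mk (f w)} * L
        \<le> 4 * card {w \<in> V. blk (f w) = blk (f u)}"
      using bl fW card[of "\<lambda>y. blk y = blk (f u) \<and> mk y"] card[of "\<lambda>y. blk y = blk (f u)"]
      by (simp add: blocking_def)
  next
    fix u w assume uw: "u \<in> V" "w \<in> reach E 2 u" "\<not> mk (f u)" "\<not> mk (f w)"
    have "f w \<in> reach F 2 (f u)"
      using uw fE reach_map[of E f F] by blast
    then show "blk (f u) = blk (f w)"
      using bl uw fW unfolding blocking_def by blast
  next
    show "case e of (u, w) \<Rightarrow> (blk (f u) = blk (f w)) = (col (f u) = col (f w))" if "e \<in> E" for e
      using bl fE that unfolding blocking_def by blast
  qed
qed

section \<open>Explicit blockings\<close>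

lemma bidx_const: "n < L \<Longrightarrow> bidx n L i = 0"
  by (simp add: bidx_def)

lemma bidx_Suc_cases:
  "L \<ge> 1 \<Longrightarrow> bidx n L (Suc i) = bidx n L i \<or> bidx n L (Suc i) = Suc (bidx n L i)"
  using bidx_Suc[of L n i] bidx_mono[of i "Suc i" n L] by linarith

text \<open>The blocks of a cycle form a cycle themselves, possibly of odd length, so the last one gets a
  third colour.\<close>

lemma blocking_cycle:
  fixes n L :: nat
  assumes L: "L \<ge> 1"
  defines "N \<equiv> n div L - 1"
  defines "col \<equiv> \<lambda>i. if bidx n L i = N then (True, True) else (odd (bidx n L i), False)"
  shows "blocking {..<n} (cycle_adj n) L (\<lambda>i. (bidx n L i, 0::nat)) col (bstart n L)"
proof -
  have le: "bidx n L i \<le> N" for i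
    by (simp add: bidx_def N_def)
  have last: "bidx n L i = N" if "Suc i = n" for i
  proof (cases "n < L")
    case True
    then show ?thesis
      by (simp add: bidx_def N_def)
  next
    case False
    have "N * L \<le> i"
    proof (cases N)
      case (Suc N')
      have "Suc N * L \<le> n div L * L"
        by (intro mult_le_mono1) (use Suc in \<open>simp add: N_def\<close>)
      also have "\<dots> \<le> Suc i"
        using that by simp
      finally show ?thesis
        using L by simp
    qed simp
    then show ?thesis
      using bidx_geI[OF L, of N n i] le[of i] by (simp add: N_def)
  qed
  have step: "bidx n L i = bidx n L j \<longleftrightarrow> col i = col j" if "i < n" "j = Suc i mod n" for i j
  proof (cases "Suc i = n")
    \<comment> \<open>The closing edge joins block \<open>N\<close> to block 0. The third colour
      belongs to block \<open>N\<close> alone, so the colours agree exactly when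
      \<open>N = 0\<close>.\<close>
    case True
    then show ?thesis
      using that last[of i] by (auto simp: col_def bidx_def)
  next
    case False
    then have "j = Suc i"
      using that by simp
    then show ?thesis
      using bidx_Suc_cases[OF L, of n i]
    proof (elim disjE)
      assume Suc: "bidx n L (Suc i) = Suc (bidx n L i)"
      then have "col i = (odd (bidx n L i), False)"
        using le[of "Suc i"] by (simp add: col_def)
      moreover have "col (Suc i) = (True, True) \<or> col (Suc i) = (even (bidx n L i), False)"
        by (simp add: col_def Suc)
      ultimately show ?thesis
        using Suc \<open>j = Suc i\<close> by auto
    qed (simp add: col_def)
  qed
  have symc: "sym (cycle_adj n)"
    by (auto simp: sym_def cycle_adj_def)
  show ?thesis
    unfolding blocking_def
  proof (intro conjI ballI impI)
    show "case e of (u, w) \<Rightarrow> ((bidx n L u, 0::nat) = (bidx n L w, 0)) = (col u = col w)"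
      if e: "e \<in> cycle_adj n" for e
    proof -
      obtain i j where ij: "e = (i, j)" "i < n" "j < n" "j = Suc i mod n \<or> i = Suc j mod n"
        using e by (auto simp: cycle_adj_def)
      then have "bidx n L i = bidx n L j \<longleftrightarrow> col i = col j"
        using step[of i j] step[of j i] by metis
      then show ?thesis
        by (simp add: ij(1))
    qed
  next
    fix i j assume ij: "i \<in> {..<n}" "j \<in> {..<n}" "(bidx n L i, 0::nat) = (bidx n L j, 0)"
    have "id j \<in> reach {(x, y) \<in> cycle_adj n. (bidx n L x, 0::nat) = (bidx n L y, 0)} (2 * L) (id i)"
      using ij symc by (intro reach_bidx[OF L]) (auto simp: sym_def cycle_adj_def)
    then show "j \<in> reach {(x, y) \<in> cycle_adj n. (bidx n L x, 0::nat) = (bidx n L y, 0)} (4 * L) i"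
      using subsetD[OF reach_mono[of "2 * L" "4 * L"]] by simp
  next
    fix i assume "i \<in> {..<n}"
    then show "card {w \<in> {..<n}. (bidx n L w, 0::nat) = (bidx n L i, 0) \<and> bstart n L w} * L
        \<le> 4 * card {w \<in> {..<n}. (bidx n L w, 0::nat) = (bidx n L i, 0)}"
      using card_bstart[OF L, of i n] by simp
  next
    fix i j assume ij: "i \<in> {..<n}" "j \<in> reach (cycle_adj n) 2 i"
      and mk: "\<not> bstart n L i" "\<not> bstart n L j"
    have S: "Suc x mod n = (if Suc x = n then 0 else Suc x)" if "x < n" for x
      using that by simp
    have adj: "(x, y) \<in> cycle_adj n \<longleftrightarrow> x < n \<and> y < n \<and>
        (y = Suc x \<or> x = Suc y \<or> Suc x = n \<and> y = 0 \<or> Suc y = n \<and> x = 0)" for x y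
      using S[of x] S[of y] unfolding cycle_adj_def by (auto split: if_splits)
    \<comment> \<open>A walk of at most two steps across the closing edge starts or ends at position
      0 or 1. Such a position is marked unless \<open>n < L\<close>, and then there is only one
      block.\<close>
    have "i \<le> j \<and> j \<le> i + 2 \<or> j \<le> i \<and> i \<le> j + 2 \<or> i < 2 \<or> j < 2"
      using ij(2) unfolding reach_2 adj by auto
    then consider "i \<le> j" "j \<le> i + 2" | "j \<le> i" "i \<le> j + 2" | "i < 2" | "j < 2"
      by blast
    then have "bidx n L i = bidx n L j"
    proof cases
      case 1
      then show ?thesis using bidx_close[OF L] mk by blast
    next
      case 2
      then show ?thesis using bidx_close[OF L] mk by metis
    next
      case 3
      then have "n < L" using mk by (simp add: bstart_def)
      then show ?thesis by (simp add: bidx_const)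
    next
      case 4
      then have "n < L" using mk by (simp add: bstart_def)
      then show ?thesis by (simp add: bidx_const)
    qed
    then show "(bidx n L i, 0::nat) = (bidx n L j, 0)"
      by simp
  qed
qed

text \<open>The product of two interval blockings. A grid edge changes one coordinate by one, hence
  at most one block index and by at most one, so a checkerboard colouring by parity suffices. A walk
  inside a block treats the coordinates one after the other, which gives 2 * L + 2 * L.\<close>

lemma blocking_grid:
  fixes p q L :: nat
  assumes L: "L \<ge> 1"
  defines "blk \<equiv> \<lambda>(i, j). (bidx p L i, bidx q L j)"
  defines "col \<equiv> \<lambda>(i, j). (odd (bidx p L i + bidx q L j), False)"
  defines "mk \<equiv> \<lambda>(i, j). bstart p L i \<or> bstart q L j"
  shows "blocking ({..<p} \<times> {..<q}) (grid_adj p q) L blk col mk"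
  unfolding blocking_def
proof (intro conjI ballI impI)
  show "case e of (u, w) \<Rightarrow> (blk u = blk w) = (col u = col w)" if "e \<in> grid_adj p q" for e
  proof -
    have 1: "bidx n L (Suc x) = bidx n L x \<longleftrightarrow> even (bidx n L (Suc x)) = even (bidx n L x)"
        "bidx n L x = bidx n L (Suc x) \<longleftrightarrow> even (bidx n L (Suc x)) = even (bidx n L x)" for n x
      using bidx_Suc_cases[OF L, of n x] by auto
    show ?thesis
      using that unfolding grid_adj_def blk_def col_def
      by (auto simp: 1)
  qed
next
  fix u w assume uw: "u \<in> {..<p} \<times> {..<q}" "w \<in> {..<p} \<times> {..<q}" "blk u = blk w"
  obtain i j i' j' where e: "u = (i, j)" "w = (i', j')"
    by fastforce
  let ?E = "{(x, y) \<in> grid_adj p q. blk x = blk y}"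
  have sy: "sym ?E"
    by (auto simp: sym_def grid_adj_def)
  have "(i', j) \<in> reach ?E (2 * L) (i, j)"
    using uw e by (intro reach_bidx[OF L sy, of i p i' "\<lambda>x. (x, j)"])
      (auto simp: blk_def grid_adj_def)
  moreover have "(i', j') \<in> reach ?E (2 * L) (i', j)"
    using uw e by (intro reach_bidx[OF L sy, of j q j' "\<lambda>x. (i', x)"])
      (auto simp: blk_def grid_adj_def)
  ultimately have "(i', j') \<in> reach ?E (2 * L + 2 * L) (i, j)"
    by (rule reach_trans)
  then show "w \<in> reach ?E (4 * L) u"
    by (simp add: e)
next
  fix u assume u: "u \<in> {..<p} \<times> {..<q}"
  obtain i j where e: "u = (i, j)"
    by fastforce
  define A where "A = {x. x < p \<and> bidx p L x = bidx p L i}"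
  define A' where "A' = {x. x < p \<and> bidx p L x = bidx p L i \<and> bstart p L x}"
  define B where "B = {x. x < q \<and> bidx q L x = bidx q L j}"
  define B' where "B' = {x. x < q \<and> bidx q L x = bidx q L j \<and> bstart q L x}"
  \<comment> \<open>A node is marked when either coordinate is, so the marked part is covered by two
    products, each of density at most 2 / L in \<open>A \<times> B\<close>.\<close>
  have "{w \<in> {..<p} \<times> {..<q}. blk w = blk u \<and> mk w} = A' \<times> B \<union> A \<times> B'"
    by (auto simp: blk_def mk_def e A_def A'_def B_def B'_def)
  then have "card {w \<in> {..<p} \<times> {..<q}. blk w = blk u \<and> mk w} \<le> card (A' \<times> B) + card (A \<times> B')"
    using card_Un_le by metis
  then have "card {w \<in> {..<p} \<times> {..<q}. blk w = blk u \<and> mk w} * L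
      \<le> (card A' * L) * card B + card A * (card B' * L)"
    using mult_le_mono1[of "card {w \<in> {..<p} \<times> {..<q}. blk w = blk u \<and> mk w}" _ L]
    by (fastforce simp: card_cartesian_product algebra_simps)
  also have "\<dots> \<le> (2 * card A) * card B + card A * (2 * card B)"
    using card_bstart[OF L, of i p] card_bstart[OF L, of j q] u e
    unfolding A_def A'_def B_def B'_def by (intro add_mono mult_le_mono1 mult_le_mono2) auto
  also have "\<dots> = 4 * card (A \<times> B)"
    by (simp add: card_cartesian_product)
  also have "A \<times> B = {w \<in> {..<p} \<times> {..<q}. blk w = blk u}"
    by (auto simp: blk_def e A_def B_def)
  finally show "card {w \<in> {..<p} \<times> {..<q}. blk w = blk u \<and> mk w} * L
      \<le> 4 * card {w \<in> {..<p} \<times> {..<q}. blk w = blk u}" .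
next
  fix u w assume uw: "u \<in> {..<p} \<times> {..<q}" "w \<in> reach (grid_adj p q) 2 u"
    and mk: "\<not> mk u" "\<not> mk w"
  obtain i j i' j' where e: "u = (i, j)" "w = (i', j')"
    by fastforce
  have close: "bidx n L x = bidx n L y"
    if "x \<le> y + 2" "y \<le> x + 2" "\<not> bstart n L x" "\<not> bstart n L y" for n x y
  proof (cases "x \<le> y")
    case True
    show ?thesis
      by (rule bidx_close[OF L True that(2,4)])
  next
    case False
    then have "y \<le> x"
      by simp
    from bidx_close[OF L this that(1,3)] show ?thesis
      by (rule sym)
  qed
  have "i \<le> i' + 2 \<and> i' \<le> i + 2 \<and> j \<le> j' + 2 \<and> j' \<le> j + 2"
    using uw(2) unfolding reach_2 e by (auto simp: grid_adj_def)
  then show "blk u = blk w"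
    using mk close[of i i' p] close[of j j' q] by (simp add: e blk_def mk_def)
qed

lemma wf_instI:
  "connected_simple_graph (verts I) (adj I) \<Longrightarrow> identity_assignment c I \<Longrightarrow> wf_inst I"
  by (simp add: wf_inst_def connected_simple_graph_def identity_assignment_def)

lemma labeled_cycle_blocking:
  assumes "labeled_cycle (I :: 'v inst)" "L \<ge> 1"
  shows "\<exists>(blk :: 'v \<Rightarrow> nat \<times> nat) col mk. blocking (verts I) (adj I) L blk col mk"
proof -
  obtain n f where f: "bij_betw f (verts I) {..<n}"
    "\<forall>u\<in>verts I. \<forall>v\<in>verts I. (u, v) \<in> adj I \<longleftrightarrow> (f u, f v) \<in> cycle_adj n"
    using assms(1) by (auto simp: labeled_cycle_def graph_iso_def)
  have "adj I \<subseteq> verts I \<times> verts I"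
    using assms(1) by (simp add: labeled_cycle_def connected_simple_graph_def)
  moreover have "cycle_adj n \<subseteq> {..<n} \<times> {..<n}"
    by (auto simp: cycle_adj_def)
  ultimately show ?thesis
    using blocking_iso[OF f(1) _ _ f(2) blocking_cycle[OF assms(2)]] by blast
qed

lemma labeled_grid_blocking:
  assumes "labeled_grid (I :: 'v inst)" "L \<ge> 1"
  shows "\<exists>(blk :: 'v \<Rightarrow> nat \<times> nat) col mk. blocking (verts I) (adj I) L blk col mk"
proof -
  obtain p q f where f: "bij_betw f (verts I) ({..<p} \<times> {..<q})"
    "\<forall>u\<in>verts I. \<forall>v\<in>verts I. (u, v) \<in> adj I \<longleftrightarrow> (f u, f v) \<in> grid_adj p q"
    using assms(1) unfolding labeled_grid_def graph_iso_def by blast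
  have "adj I \<subseteq> verts I \<times> verts I"
    using assms(1) by (simp add: labeled_grid_def connected_simple_graph_def)
  moreover have "grid_adj p q \<subseteq> ({..<p} \<times> {..<q}) \<times> ({..<p} \<times> {..<q})"
    by (auto simp: grid_adj_def)
  ultimately show ?thesis
    using blocking_iso[OF f(1) _ _ f(2) blocking_grid[OF assms(2)]] by blast
qed

theorem corollary10:
  fixes P :: "'v inst \<Rightarrow> bool" and k :: "nat \<Rightarrow> nat" and c :: nat
  assumes "c \<ge> 1"
  shows
    "((\<exists>p vf. is_pls labeled_cycle c P 1 p vf \<and> (\<forall>n. pls_size labeled_cycle c P p n = enat (k n))) \<longrightarrow>
      (\<exists>C::nat. \<forall>t\<ge>1.
        size_pls_bounded labeled_cycle c P t (\<lambda>n. C * nat \<lceil>real (k n) / real t\<rceil>))) \<and>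
     ((\<exists>p vf. is_pls labeled_grid c P 1 p vf \<and> (\<forall>n. pls_size labeled_grid c P p n = enat (k n))) \<longrightarrow>
      (\<exists>C::nat. \<forall>t\<ge>1.
        size_pls_bounded labeled_grid c P t (\<lambda>n. C * nat \<lceil>real (k n) / real t\<rceil>)))"
proof -
  have "size_pls_bounded labeled_cycle c P t (\<lambda>n. 243 * nat \<lceil>real (k n) / real t\<rceil>)"
    if "is_pls labeled_cycle c P 1 p vf" "\<And>n. pls_size labeled_cycle c P p n = enat (k n)" "t \<ge> 1"
    for p vf t
  proof (rule size_pls_bounded_by_blocking[OF _ _ that])
    show "wf_inst I" if "I \<in> instances labeled_cycle c" for I :: "'v inst"
      using that wf_instI[of I c] by (simp add: instances_def labeled_cycle_def)
    show "\<exists>(blk :: 'v \<Rightarrow> nat \<times> nat) col mk. blocking (verts I) (adj I) L blk col mk"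
      if "I \<in> instances labeled_cycle c" "L \<ge> 1" for I L
      using that labeled_cycle_blocking[of I L] by (simp add: instances_def)
  qed
  moreover have "size_pls_bounded labeled_grid c P t (\<lambda>n. 243 * nat \<lceil>real (k n) / real t\<rceil>)"
    if "is_pls labeled_grid c P 1 p vf" "\<And>n. pls_size labeled_grid c P p n = enat (k n)" "t \<ge> 1"
    for p vf t
  proof (rule size_pls_bounded_by_blocking[OF _ _ that])
    show "wf_inst I" if "I \<in> instances labeled_grid c" for I :: "'v inst"
      using that wf_instI[of I c] by (simp add: instances_def labeled_grid_def)
    show "\<exists>(blk :: 'v \<Rightarrow> nat \<times> nat) col mk. blocking (verts I) (adj I) L blk col mk"
      if "I \<in> instances labeled_grid c" "L \<ge> 1" for I L
      using that labeled_grid_blocking[of I L] by (simp add: instances_def)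
  qed
  ultimately show ?thesis
    by blast
qed

end
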